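(* Let $n\ge 1$ and $P\in\mathcal{P}^n$. If all (complex) roots of $\mathrm{G}(s,P)$ have real part $-1/2$, then, up to a unimodular translation (i.e., after translating $P$ by a suitable vector of $\mathbb{Z}^n$), $P$ is a reflexive polytope of volume $\mathrm{vol}(P)\leq 2^n$.
   Context: $\mathcal{P}^n$ is the set of all convex lattice $n$-polytopes in $\mathbb{R}^n$ (vertices in $\mathbb{Z}^n$, dimension $n$). For $P\in\mathcal{P}^n$ the number $\#(kP\cap\mathbb{Z}^n)$ is, for $k\in\mathbb{N}$, a polynomial $\sum_{i=0}^n \mathrm{G}_i(P)k^i$ of degree $n$ (the Ehrhart polynomial); $\mathrm{G}(s,P)=\sum_{i=0}^n\mathrm{G}_i(P)s^i$ for $s\in\mathbb{C}$. A polytope $P\in\mathcal{P}^n$ with $0\in\mathrm{int}\,P$ is called reflexive if its polar $P^\star=\{y\in\mathbb{R}^n : x\cdot y\leq 1\text{ for all }x\in P\}$ also belongs to $\mathcal{P}^n$. $\mathrm{vol}$ is the $n$-dimensional Lebesgue measure. *)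

theory Defs
  imports
    "HOL-Analysis.Analysis"
    "HOL-Computational_Algebra.Polynomial"
begin

definition int_lattice :: "(real ^ 'n) set" where
  "int_lattice = {x. \<forall>i. x $ i \<in> \<int>}"

definition lattice_polytope :: "(real ^ 'n) set \<Rightarrow> bool" where
  "lattice_polytope P \<longleftrightarrow>
     polytope P \<and> {v. v extreme_point_of P} \<subseteq> int_lattice \<and> aff_dim P = int CARD('n)"

definition lattice_count :: "(real ^ 'n) set \<Rightarrow> nat" where
  "lattice_count S = card (S \<inter> int_lattice)"

(* Existence of such a polynomial for lattice polytopes is Ehrhart's theorem; uniqueness
   holds for every set P, see ehrhart_poly_eqI. Starting at k = 1 rather than k = 0 makes no
   difference for lattice polytopes, whose Ehrhart polynomial has constant term 1. *)
definition ehrhart_poly :: "(real ^ 'n) set \<Rightarrow> complex poly" where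
  "ehrhart_poly P =
     (THE p. \<forall>k\<ge>1. poly p (of_nat k) = of_nat (lattice_count ((*\<^sub>R) (real k) ` P)))"

definition polar :: "(real ^ 'n) set \<Rightarrow> (real ^ 'n) set" where
  "polar P = {y. \<forall>x\<in>P. x \<bullet> y \<le> 1}"

definition reflexive_polytope :: "(real ^ 'n) set \<Rightarrow> bool" where
  "reflexive_polytope P \<longleftrightarrow>
     lattice_polytope P \<and> 0 \<in> interior P \<and> lattice_polytope (polar P)"

lemma ehrhart_poly_eqI:
  fixes P :: "(real ^ 'n) set"
  assumes p: "\<And>k. k \<ge> 1 \<Longrightarrow> poly p (of_nat k) = of_nat (lattice_count ((*\<^sub>R) (real k) ` P))"
  shows "ehrhart_poly P = p"
  unfolding ehrhart_poly_def
proof (rule the_equality)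
  fix q :: "complex poly"
  assume q: "\<forall>k\<ge>1. poly q (of_nat k) = of_nat (lattice_count ((*\<^sub>R) (real k) ` P))"
  have "infinite ((of_nat :: nat \<Rightarrow> complex) ` {1..})"
    by (simp add: finite_image_iff inj_on_def infinite_Ici)
  moreover have "(of_nat :: nat \<Rightarrow> complex) ` {1..} \<subseteq> {x. poly (q - p) x = 0}"
    using p q by auto
  ultimately have "infinite {x. poly (q - p) x = 0}"
    using finite_subset by blast
  then have "q - p = 0"
    using poly_roots_finite by blast
  then show "q = p"
    by simp
qed (use p in blast)

end

theory Submission
  imports
    Defs
    "HOL-Computational_Algebra.Fundamental_Theorem_Algebra"
begin

text \<open>
  Let \<open>G\<close> be the Ehrhart polynomial of \<open>P\<close>, and write \<open>n\<close> for the dimension. The proof rests on three facts: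
  \<open>G\<close> exists and has degree at most \<open>n\<close>, its constant term is \<open>1\<close>, and it satisfies Macdonald's reciprocity law:
  \<open>(- 1) ^ n * G (- k)\<close> is the number of lattice points in the interior of \<open>k P\<close>. All of this is proved
  here as \<open>ehrhart_macdonald\<close>.

  If all roots have real part \<open>- 1 / 2\<close>, then the numbers \<open>k\<close> and \<open>- 1 - k\<close>, being mirror images in the
  line that carries the roots, have the same distances to all roots, so
  \<open>cmod (G (- 1 - k)) = cmod (G k)\<close>. By reciprocity, the interior of \<open>(k + 1) P\<close> contains as many lattice points as \<open>k P\<close>.
  For \<open>k = 0\<close> this number is \<open>G 0 = 1\<close>, and the unique interior lattice point of \<open>P\<close> may be translated to the origin.
  Then \<open>k P\<close> lies in the interior of \<open>(k + 1) P\<close>, and by the equality of the numbers there is no lattice point strictly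
  between their boundaries. This forces every facet of \<open>P\<close> to lie at lattice distance one from the origin, which is
  to say that the vertices of the polar are lattice points (\<open>lattice_polytope_polar\<close>).

  For the volume, the roots have modulus at least \<open>1 / 2\<close> and \<open>G 0 = 1\<close>, hence \<open>cmod (G k) \<le> (1 + 2 * k) ^ n\<close>. On the other
  hand the number of lattice points of \<open>k P\<close> grows at least like \<open>k ^ n * vol P\<close>.

  The facts on \<open>G\<close> come from a dissection of \<open>P\<close> into lattice simplices, obtained by projecting the lower hull of a
  generic lifting of the vertices. Choose a generic interior point \<open>q\<close>, and remove from each simplex the facets visible
  from \<open>q\<close>: the half-open simplices partition \<open>P\<close>, and if the other facets are removed instead they
  partition the interior of \<open>P\<close>. The lattice points in the dilates of a half-open simplex are counted by the fundamental parallelepiped of the cone over it, and the point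
  reflection of the parallelepiped exchanges removed and kept facets, which gives reciprocity.
\<close>

section \<open>Barycentric coordinates\<close>

definition affine_basis :: "'a::euclidean_space set \<Rightarrow> bool" where
  "affine_basis S \<longleftrightarrow> finite S \<and> \<not> affine_dependent S \<and> affine hull S = UNIV"

definition bary :: "'a::euclidean_space set \<Rightarrow> 'a \<Rightarrow> 'a \<Rightarrow> real" where
  "bary S x = (SOME u. sum u S = 1 \<and> (\<Sum>s\<in>S. u s *\<^sub>R s) = x)"

lemma card_affine_basis:
  fixes S :: "'a::euclidean_space set"
  assumes "affine_basis S"
  shows "card S = Suc DIM('a)"
proof -
  have "aff_dim S = DIM('a)"
    using assms by (simp add: affine_basis_def aff_dim_eq_full)
  then show ?thesis
    using assms aff_dim_affine_independent[of S] by (simp add: affine_basis_def)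
qed

lemma affine_basisI:
  fixes S :: "'a::euclidean_space set"
  assumes "finite S" "card S \<le> Suc DIM('a)" "affine hull S = UNIV"
  shows "affine_basis S"
proof -
  have "aff_dim S = DIM('a)"
    using assms(3) by (simp add: aff_dim_eq_full)
  moreover have "aff_dim S \<le> int (card S) - 1"
    by (rule aff_dim_le_card[OF assms(1)])
  ultimately have "aff_dim S = int (card S) - 1"
    using assms(2) by linarith
  then show ?thesis
    using assms by (simp add: affine_basis_def affine_independent_iff_card)
qed

lemma bary:
  fixes S :: "'a::euclidean_space set"
  assumes "affine_basis S"
  shows sum_bary: "sum (bary S x) S = 1"
    and sum_bary_scaleR: "(\<Sum>s\<in>S. bary S x s *\<^sub>R s) = x"
proof -
  have "x \<in> affine hull S"
    using assms by (simp add: affine_basis_def)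
  then have "\<exists>u. sum u S = 1 \<and> (\<Sum>s\<in>S. u s *\<^sub>R s) = x"
    using assms by (auto simp: affine_basis_def affine_hull_finite)
  then have "sum (bary S x) S = 1 \<and> (\<Sum>s\<in>S. bary S x s *\<^sub>R s) = x"
    unfolding bary_def by (rule someI_ex)
  then show "sum (bary S x) S = 1" "(\<Sum>s\<in>S. bary S x s *\<^sub>R s) = x"
    by auto
qed

lemma affine_basis_combination_unique:
  fixes S :: "'a::euclidean_space set"
  assumes "affine_basis S" "sum u S = sum v S" "(\<Sum>s\<in>S. u s *\<^sub>R s) = (\<Sum>s\<in>S. v s *\<^sub>R s)" "s \<in> S"
  shows "u s = v s"
proof (rule ccontr)
  let ?w = "\<lambda>s. u s - v s"
  assume "u s \<noteq> v s"
  then have "\<exists>s\<in>S. ?w s \<noteq> 0"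
    using assms(4) by (auto intro!: bexI[of _ s])
  moreover have "sum ?w S = 0" "(\<Sum>s\<in>S. ?w s *\<^sub>R s) = 0"
    using assms by (simp_all add: sum_subtractf scaleR_left_diff_distrib)
  ultimately have "affine_dependent S"
    using assms(1) unfolding affine_basis_def
    by (subst affine_dependent_explicit_finite) (auto intro!: exI[of _ ?w])
  then show False
    using assms(1) by (simp add: affine_basis_def)
qed

lemma bary_unique:
  fixes S :: "'a::euclidean_space set"
  assumes "affine_basis S" "sum u S = 1" "(\<Sum>s\<in>S. u s *\<^sub>R s) = x" "s \<in> S"
  shows "bary S x s = u s"
  by (rule affine_basis_combination_unique[OF assms(1) _ _ assms(4)])
     (simp_all only: sum_bary[OF assms(1)] sum_bary_scaleR[OF assms(1)] assms(2,3))

lemma bary_affine: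
  assumes "affine_basis S" "s \<in> S"
  shows "bary S (x + t *\<^sub>R (q - x)) s = bary S x s + t * (bary S q s - bary S x s)"
proof (rule bary_unique[OF assms(1) _ _ assms(2)])
  show "(\<Sum>s\<in>S. bary S x s + t * (bary S q s - bary S x s)) = 1"
    by (simp add: sum.distrib sum_subtractf flip: sum_distrib_left)
       (simp add: sum_bary[OF assms(1)])
  have "(\<Sum>s\<in>S. (bary S x s + t * (bary S q s - bary S x s)) *\<^sub>R s) =
        (\<Sum>s\<in>S. bary S x s *\<^sub>R s) + t *\<^sub>R ((\<Sum>s\<in>S. bary S q s *\<^sub>R s) - (\<Sum>s\<in>S. bary S x s *\<^sub>R s))"
    by (simp add: algebra_simps sum.distrib sum_subtractf scaleR_sum_right)
  then show "(\<Sum>s\<in>S. (bary S x s + t * (bary S q s - bary S x s)) *\<^sub>R s) = x + t *\<^sub>R (q - x)"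
    by (simp add: sum_bary_scaleR[OF assms(1)])
qed

lemma mem_convex_hull_iff_bary:
  assumes "affine_basis S"
  shows "x \<in> convex hull S \<longleftrightarrow> (\<forall>s\<in>S. 0 \<le> bary S x s)"
proof
  assume "x \<in> convex hull S"
  then obtain u where u: "\<forall>s\<in>S. 0 \<le> u s" "sum u S = 1" "(\<Sum>s\<in>S. u s *\<^sub>R s) = x"
    using assms by (auto simp: affine_basis_def convex_hull_finite)
  then show "\<forall>s\<in>S. 0 \<le> bary S x s"
    using bary_unique[OF assms u(2,3)] by simp
next
  assume "\<forall>s\<in>S. 0 \<le> bary S x s"
  then show "x \<in> convex hull S"
    using assms bary[OF assms, of x] by (auto simp: affine_basis_def convex_hull_finite)
qed

text \<open>
  A point in general position with respect to \<open>V\<close> lies on no proper affine subspace spanned by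
  points of \<open>V\<close>; in particular no barycentric coordinate vanishes with respect to a simplex with vertices in \<open>V\<close>.
\<close>

definition generic_point :: "'a::euclidean_space set \<Rightarrow> 'a \<Rightarrow> bool" where
  "generic_point V y \<longleftrightarrow> (\<forall>F\<subseteq>V. y \<in> affine hull F \<longrightarrow> affine hull F = UNIV)"

lemma generic_point_bary_nonzero:
  assumes S: "affine_basis S" "S \<subseteq> V" and y: "generic_point V y" and s: "s \<in> S"
  shows "bary S y s \<noteq> 0"
proof
  assume 0: "bary S y s = 0"
  have fin: "finite S"
    using S by (simp add: affine_basis_def)
  have "sum (bary S y) (S - {s}) = 1" "(\<Sum>r\<in>S - {s}. bary S y r *\<^sub>R r) = y"
    using bary[OF S(1), of y] fin s 0 by (simp_all add: sum.remove[of S s])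
  then have "y \<in> affine hull (S - {s})"
    using fin by (auto simp: affine_hull_finite)
  moreover have "S - {s} \<subseteq> V"
    using S(2) by blast
  ultimately have "affine hull (S - {s}) = UNIV"
    using y unfolding generic_point_def by blast
  then have "s \<in> affine hull (S - {s})"
    by simp
  then show False
    using S(1) s by (auto simp: affine_basis_def affine_dependent_def)
qed

section \<open>Regular dissections into simplices\<close>

text \<open>
  The affine function that takes the prescribed heights \<open>c\<close> on the affine basis \<open>S\<close>.
\<close>

definition lift :: "('a::euclidean_space \<Rightarrow> real) \<Rightarrow> 'a set \<Rightarrow> 'a \<Rightarrow> real" where
  "lift c S x = (\<Sum>s\<in>S. bary S x s * c s)"

lemma lift_vertex:
  assumes "affine_basis S" "s \<in> S"
  shows "lift c S s = c s"
proof -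
  have fin: "finite S"
    using assms by (simp add: affine_basis_def)
  have "bary S s r = of_bool (r = s)" if "r \<in> S" for r
    by (rule bary_unique[OF assms(1) _ _ that]) (use fin assms in \<open>simp_all add: of_bool_def if_distrib[of "\<lambda>x. x *\<^sub>R _"] cong: if_cong\<close>)
  then have "lift c S s = (\<Sum>r\<in>S. of_bool (r = s) * c r)"
    by (simp add: lift_def)
  also have "\<dots> = c s"
    using fin assms by (simp add: of_bool_def if_distrib[of "\<lambda>x. x * _"] cong: if_cong)
  finally show ?thesis .
qed

lemma lift_affine_combination:
  assumes S: "affine_basis S" and u: "sum u T = 1"
  shows "lift c S (\<Sum>t\<in>T. u t *\<^sub>R t) = (\<Sum>t\<in>T. u t * lift c S t)"
proof -
  have "bary S (\<Sum>t\<in>T. u t *\<^sub>R t) s = (\<Sum>t\<in>T. u t * bary S t s)" if "s \<in> S" for s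
  proof (rule bary_unique[OF S _ _ that])
    show "(\<Sum>s\<in>S. \<Sum>t\<in>T. u t * bary S t s) = 1"
      by (subst sum.swap) (simp add: sum_bary[OF S] u flip: sum_distrib_left)
    show "(\<Sum>s\<in>S. (\<Sum>t\<in>T. u t * bary S t s) *\<^sub>R s) = (\<Sum>t\<in>T. u t *\<^sub>R t)"
    proof -
      have "(\<Sum>s\<in>S. (\<Sum>t\<in>T. u t * bary S t s) *\<^sub>R s) = (\<Sum>t\<in>T. u t *\<^sub>R (\<Sum>s\<in>S. bary S t s *\<^sub>R s))"
        by (simp add: scaleR_sum_left scaleR_sum_right) (rule sum.swap)
      then show ?thesis
        by (simp add: sum_bary_scaleR[OF S])
    qed
  qed
  then have "lift c S (\<Sum>t\<in>T. u t *\<^sub>R t) = (\<Sum>s\<in>S. \<Sum>t\<in>T. u t * (bary S t s * c s))"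
    by (simp add: lift_def sum_distrib_right mult.assoc)
  also have "\<dots> = (\<Sum>t\<in>T. u t * lift c S t)"
    by (subst sum.swap) (simp add: lift_def sum_distrib_left)
  finally show ?thesis .
qed

text \<open>
  Heights are generic when no point \<open>(v, c v)\<close> of the lifted configuration lies on the graph of an
  affine function through the liftings of an affine basis of other points. This is what makes the lower hull of the
  lifted configuration simplicial.
\<close>

definition generic_heights :: "'a::euclidean_space set \<Rightarrow> ('a \<Rightarrow> real) \<Rightarrow> bool" where
  "generic_heights V c \<longleftrightarrow> (\<forall>S\<subseteq>V. affine_basis S \<longrightarrow> (\<forall>v\<in>V - S. lift c S v \<noteq> c v))"

text \<open>
  Number the points and put \<open>c v = t ^ i v\<close>. Each forbidden coincidence is then the vanishing at \<open>t\<close> of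
  a polynomial, nonzero because its coefficient at \<open>i v\<close> is \<open>1\<close>; there are finitely many such
  polynomials, so all but finitely many \<open>t\<close> work.
\<close>

lemma generic_heights_exist:
  fixes V :: "'a::euclidean_space set"
  assumes "finite V"
  obtains c where "generic_heights V c"
proof -
  obtain i :: "'a \<Rightarrow> nat" where i: "inj_on i V"
    using finite_imp_inj_to_nat_seg[OF assms] by blast
  let ?I = "{(S, v). S \<subseteq> V \<and> affine_basis S \<and> v \<in> V - S}"
  let ?p = "\<lambda>(S, v). monom 1 (i v) - (\<Sum>s\<in>S. monom (bary S v s) (i s))"
  have "?I \<subseteq> Pow V \<times> V"
    by auto
  then have "finite ?I"
    by (rule finite_subset) (use assms in simp)
  have nonzero: "?p (S, v) \<noteq> 0" if "(S, v) \<in> ?I" for S v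
  proof -
    have "i s \<noteq> i v" if "s \<in> S" for s
      using i that \<open>(S, v) \<in> ?I\<close> by (auto dest: inj_onD)
    then have "coeff (?p (S, v)) (i v) = 1"
      by (simp add: coeff_sum)
    then show ?thesis
      by (metis coeff_0 zero_neq_one)
  qed
  have "finite (\<Union>j\<in>?I. {t. poly (?p j) t = 0})"
    using \<open>finite ?I\<close> nonzero by (intro finite_UN_I poly_roots_finite) auto
  then obtain t where t: "t \<notin> (\<Union>j\<in>?I. {t. poly (?p j) t = 0})"
    using ex_new_if_finite[OF infinite_UNIV_char_0] by blast
  have "lift (\<lambda>v. t ^ i v) S v \<noteq> t ^ i v" if "S \<subseteq> V" "affine_basis S" "v \<in> V - S" for S v
    using t that by (force simp: lift_def poly_sum poly_monom)
  then have "generic_heights V (\<lambda>v. t ^ i v)"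
    by (auto simp: generic_heights_def)
  then show thesis ..
qed

text \<open>
  For generic heights these are the projections of the lower facets of the lifted configuration, i.e. the maximal
  cells of the regular subdivision of \<open>convex hull V\<close> induced by \<open>c\<close>. The next two lemmas show that they form a
  dissection: they cover \<open>convex hull V\<close>, and they do not overlap, up to points in special position.
\<close>

definition lower_simplices :: "'a::euclidean_space set \<Rightarrow> ('a \<Rightarrow> real) \<Rightarrow> 'a set set" where
  "lower_simplices V c = {S. S \<subseteq> V \<and> affine_basis S \<and> (\<forall>v\<in>V - S. lift c S v < c v)}"

lemma finite_lower_simplices: "finite V \<Longrightarrow> finite (lower_simplices V c)"
  by (rule finite_subset[of _ "Pow V"]) (auto simp: lower_simplices_def)

text \<open>
  On the cell \<open>S\<close>, the function \<open>lift c S\<close> dominates \<open>lift c T\<close> for any other cell \<open>T\<close>, since it does so at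
  the vertices of \<open>S\<close>. In a common point both functions therefore agree, and as the barycentric coordinates of a
  generic point of \<open>S\<close> are all positive, they agree at every vertex of \<open>S\<close>; those vertices must belong to \<open>T\<close>.
\<close>

lemma lower_simplices_unique:
  assumes y: "generic_point V y"
    and S: "S \<in> lower_simplices V c" "y \<in> convex hull S"
    and T: "T \<in> lower_simplices V c" "y \<in> convex hull T"
  shows "S = T"
proof -
  have bS: "affine_basis S" "S \<subseteq> V" and bT: "affine_basis T" "T \<subseteq> V"
    using S T by (auto simp: lower_simplices_def)
  have below: "lift c A v \<le> c v" if "A \<in> lower_simplices V c" "v \<in> V" for A v
    using that lift_vertex[of A v c] by (cases "v \<in> A") (auto simp: lower_simplices_def less_imp_le)
  have comb: "lift c B y = (\<Sum>s\<in>A. bary A y s * lift c B s)" if "affine_basis A" "affine_basis B" for A B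
    using lift_affine_combination[OF that(2) sum_bary[OF that(1)], of c y]
    by (simp add: sum_bary_scaleR[OF that(1)])
  have le: "lift c B y \<le> lift c A y"
    if "A \<in> lower_simplices V c" "B \<in> lower_simplices V c" "y \<in> convex hull A" for A B
  proof -
    have A: "affine_basis A" "A \<subseteq> V" and B: "affine_basis B"
      using that by (auto simp: lower_simplices_def)
    have "lift c B y = (\<Sum>s\<in>A. bary A y s * lift c B s)"
      by (rule comb[OF A(1) B])
    also have "\<dots> \<le> (\<Sum>s\<in>A. bary A y s * c s)"
      using that A below[OF that(2)] mem_convex_hull_iff_bary[OF A(1), of y]
      by (intro sum_mono mult_left_mono) auto
    finally show ?thesis
      by (simp add: lift_def)
  qed
  have "lift c S y = lift c T y"
    using le[OF S(1) T(1) S(2)] le[OF T(1) S(1) T(2)] by simp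
  then have zero: "(\<Sum>s\<in>S. bary S y s * (c s - lift c T s)) = 0"
    using comb[OF bS(1) bT(1)] by (simp add: right_diff_distrib sum_subtractf lift_def)
  have "S \<subseteq> T"
  proof
    fix s assume s: "s \<in> S"
    have fin: "finite S"
      using bS by (simp add: affine_basis_def)
    have nn: "0 \<le> bary S y r * (c r - lift c T r)" if "r \<in> S" for r
      using that bS S(2) below[OF T(1), of r] mem_convex_hull_iff_bary[OF bS(1), of y]
      by (auto intro!: mult_nonneg_nonneg)
    have "bary S y s * (c s - lift c T s) = 0"
      using zero sum_nonneg_eq_0_iff[OF fin, of "\<lambda>r. bary S y r * (c r - lift c T r)"] nn s by blast
    then have "c s = lift c T s"
      using generic_point_bary_nonzero[OF bS y s] by simp
    then show "s \<in> T"
      using T(1) s bS(2) by (force simp: lower_simplices_def)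
  qed
  then show "S = T"
    using card_affine_basis[OF bS(1)] card_affine_basis[OF bT(1)] bT(1)
    by (metis affine_basis_def card_subset_eq)
qed

text \<open>
  Among the simplices with vertices in \<open>V\<close> that contain \<open>y\<close> (one exists by Caratheodory's theorem),
  take one whose lifting is lowest above \<open>y\<close>. If some lifted point \<open>(v, c v)\<close> were below the hyperplane of
  this simplex, a pivot step of the simplex algorithm that lets \<open>v\<close> enter would produce a lower one.
\<close>

lemma lower_simplices_cover:
  fixes V :: "'a::euclidean_space set"
  assumes V: "finite V" and c: "generic_heights V c"
    and y: "generic_point V y" "y \<in> convex hull V"
  shows "\<exists>S\<in>lower_simplices V c. y \<in> convex hull S"
proof -
  let ?B = "{S. S \<subseteq> V \<and> affine_basis S \<and> y \<in> convex hull S}"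
  have basis: "affine_basis S" if "S \<subseteq> V" "card S \<le> Suc DIM('a)" "y \<in> convex hull S" for S
  proof (rule affine_basisI)
    show "finite S"
      using that V finite_subset by blast
    show "affine hull S = UNIV"
      using y(1) that convex_hull_subset_affine_hull[of S] by (auto simp: generic_point_def)
  qed (use that in simp)
  obtain S where S: "S \<subseteq> V" "card S \<le> aff_dim V + 1" "y \<in> convex hull S"
    using y(2) unfolding caratheodory_aff_dim[of V] by blast
  have "aff_dim V \<le> DIM('a)"
    by (rule aff_dim_le_DIM)
  then have "S \<in> ?B"
    using S basis[of S] by auto
  moreover have "finite ?B"
    by (rule finite_subset[of _ "Pow V"]) (use V in auto)
  ultimately obtain S where S: "S \<in> ?B" and min: "\<And>T. T \<in> ?B \<Longrightarrow> lift c S y \<le> lift c T y"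
    using arg_min_if_finite[of ?B "\<lambda>S. lift c S y"] by (metis (lifting) empty_iff linorder_not_le)
  have bS: "affine_basis S" "S \<subseteq> V" and fin: "finite S"
    using S by (auto simp: affine_basis_def)
  have "lift c S v < c v" if v: "v \<in> V - S" for v
  proof (rule ccontr)
    assume "\<not> lift c S v < c v"
    moreover have "lift c S v \<noteq> c v"
      using c v bS by (auto simp: generic_heights_def)
    ultimately have high: "c v < lift c S v"
      by simp
    define \<mu> where "\<mu> = bary S y"
    define \<beta> where "\<beta> = bary S v"
    note \<beta> = bary[OF bS(1), of v, folded \<beta>_def] and \<mu> = bary[OF bS(1), of y, folded \<mu>_def]
    have \<mu>_pos: "0 < \<mu> s" if "s \<in> S" for s
      using generic_point_bary_nonzero[OF bS y(1) that] mem_convex_hull_iff_bary[OF bS(1), of y] S that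
      by (auto simp: \<mu>_def order.strict_iff_order)
    let ?N = "{s\<in>S. 0 < \<beta> s}"
    have "?N \<noteq> {}"
    proof
      assume "?N = {}"
      then have "sum \<beta> S \<le> 0"
        by (intro sum_nonpos) (auto simp: not_less)
      then show False
        using \<beta>(1) by simp
    qed
    moreover have "finite ?N"
      using fin by simp
    ultimately obtain s where s: "s \<in> ?N" and smin: "\<And>r. r \<in> ?N \<Longrightarrow> \<mu> s / \<beta> s \<le> \<mu> r / \<beta> r"
      using arg_min_if_finite[of ?N "\<lambda>s. \<mu> s / \<beta> s"] by (metis (lifting) linorder_not_le)
    \<comment> \<open>Increase the weight of \<open>v\<close> until the first weight, that of \<open>s\<close>, drops to zero.\<close>
    define \<epsilon> where "\<epsilon> = \<mu> s / \<beta> s"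
    have \<epsilon>: "0 < \<epsilon>"
      using s \<mu>_pos by (simp add: \<epsilon>_def)
    define u where "u r = (if r = v then \<epsilon> else \<mu> r - \<epsilon> * \<beta> r)" for r
    define T where "T = insert v (S - {s})"
    have us: "\<mu> s - \<epsilon> * \<beta> s = 0"
      using s by (simp add: \<epsilon>_def)
    have sum_T: "(\<Sum>r\<in>T. f (u r) r) = f \<epsilon> v + (\<Sum>r\<in>S. f (\<mu> r - \<epsilon> * \<beta> r) r)" 
      if "f 0 s = 0" for f :: "real \<Rightarrow> 'a \<Rightarrow> 'c::ab_group_add"
    proof -
      have "(\<Sum>r\<in>S - {s}. f (u r) r) = (\<Sum>r\<in>S - {s}. f (\<mu> r - \<epsilon> * \<beta> r) r)"
        using v by (intro sum.cong) (auto simp: u_def)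
      also have "\<dots> = (\<Sum>r\<in>S. f (\<mu> r - \<epsilon> * \<beta> r) r)"
        using fin s us that by (subst (2) sum.remove[of _ s]) auto
      finally show ?thesis
        using v fin by (simp add: T_def u_def)
    qed
    have u1: "sum u T = 1"
      using sum_T[of "\<lambda>a r. a"] \<mu>(1) \<beta>(1) by (simp add: sum_subtractf flip: sum_distrib_left)
    have u2: "(\<Sum>r\<in>T. u r *\<^sub>R r) = y"
      using sum_T[of "\<lambda>a r. a *\<^sub>R r"] \<mu>(2) \<beta>(2)
      by (simp add: sum_subtractf scaleR_left_diff_distrib flip: scaleR_scaleR scaleR_sum_right)
    have "0 \<le> u r" if "r \<in> T" for r
    proof (cases "r = v")
      case False
      then have r: "r \<in> S"
        using that by (auto simp: T_def)
      have "\<epsilon> * \<beta> r \<le> \<mu> r"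
      proof (cases "0 < \<beta> r")
        case True
        then show ?thesis
          using smin[of r] r by (simp add: \<epsilon>_def[symmetric] pos_le_divide_eq)
      next
        case False
        then have "\<epsilon> * \<beta> r \<le> 0"
          using \<epsilon> by (simp add: mult_nonneg_nonpos)
        then show ?thesis
          using \<mu>_pos[OF r] by linarith
      qed
      then show ?thesis
        using False by (simp add: u_def)
    qed (use \<epsilon> in \<open>simp add: u_def\<close>)
    then have yT: "y \<in> convex hull T"
      using u1 u2 fin by (auto simp: convex_hull_finite T_def)
    have TV: "T \<subseteq> V"
      using v bS by (auto simp: T_def)
    have "card T = card S"
      using v s fin card_Suc_Diff1[of S s] by (simp add: T_def)
    then have bT: "affine_basis T"
      using basis[OF TV _ yT] card_affine_basis[OF bS(1)] by simp
    have "lift c T y = (\<Sum>r\<in>T. u r * c r)"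
      using bary_unique[OF bT u1 u2] by (simp add: lift_def)
    also have "\<dots> = lift c S y - \<epsilon> * (lift c S v - c v)"
      using sum_T[of "\<lambda>a r. a * c r"]
      by (simp add: lift_def \<mu>_def \<beta>_def sum_subtractf left_diff_distrib sum_distrib_left algebra_simps)
    also have "\<dots> < lift c S y"
      using \<epsilon> high by simp
    finally show False
      using min[of T] TV bT yT by simp
  qed
  then show ?thesis
    using S by (auto simp: lower_simplices_def)
qed

section \<open>Half-open simplices\<close>

definition halfopen_simplex :: "'a::euclidean_space set \<Rightarrow> 'a set \<Rightarrow> 'a set" where
  "halfopen_simplex S A = {x. \<forall>s\<in>S. if s \<in> A then 0 < bary S x s else 0 \<le> bary S x s}"

text \<open>
  The facets opposite to these vertices are the ones visible from \<open>q\<close>.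
\<close>

definition beyond :: "'a::euclidean_space set \<Rightarrow> 'a \<Rightarrow> 'a set" where
  "beyond S q = {s\<in>S. bary S q s < 0}"

lemma generic_point_exists:
  fixes V :: "'a::euclidean_space set"
  assumes "finite V" "open U" "U \<noteq> {}"
  obtains q where "q \<in> U" "generic_point V q"
proof -
  let ?H = "(\<lambda>F. affine hull F) ` {F. F \<subseteq> V \<and> affine hull F \<noteq> UNIV}"
  have empty: "interior (\<Union>\<H>) = {}" if "finite \<H>" "\<And>H. H \<in> \<H> \<Longrightarrow> affine H \<and> H \<noteq> UNIV" for \<H> :: "'a set set"
    using that
  proof (induction \<H> rule: finite_induct)
    case (insert H \<H>)
    have "interior H = {}"
      using affine_hull_nonempty_interior[of H] insert.prems[of H] hull_same[of affine H] by auto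
    moreover have "closed H"
      using insert.prems[of H] affine_closed by blast
    moreover have "interior (\<Union>\<H>) = {}"
      using insert.prems by (intro insert.IH) auto
    ultimately show ?case
      using interior_closed_Un_empty_interior[of H "\<Union>\<H>"] by simp
  qed simp
  have "interior (\<Union>?H) = {}"
  proof (rule empty)
    show "finite ?H"
      using assms(1) by simp
    show "affine H \<and> H \<noteq> UNIV" if "H \<in> ?H" for H
      using that affine_affine_hull by blast
  qed
  then have "\<not> U \<subseteq> \<Union>?H"
    using assms interior_maximal by blast
  then obtain q where "q \<in> U" "q \<notin> \<Union>?H"
    by blast
  then show thesis
    using that[of q] by (auto simp: generic_point_def)
qed

text \<open>
  A hyperplane through \<open>x\<close> that misses \<open>q\<close> meets the line through \<open>x\<close> and \<open>q\<close> in \<open>x\<close> only, and a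
  hyperplane that misses \<open>x\<close> also misses a neighbourhood of \<open>x\<close>.
\<close>

lemma eventually_generic_point:
  fixes V :: "'a::euclidean_space set"
  assumes V: "finite V" and q: "generic_point V q" and \<sigma>: "\<sigma> \<noteq> 0"
  shows "\<forall>\<^sub>F t in at_right 0. generic_point V (x + (t * \<sigma>) *\<^sub>R (q - x))"
proof -
  have "\<forall>\<^sub>F t in at_right 0. x + (t * \<sigma>) *\<^sub>R (q - x) \<notin> affine hull F"
    if F: "F \<subseteq> V" "affine hull F \<noteq> UNIV" for F
  proof (cases "x \<in> affine hull F")
    case True
    have q': "q \<notin> affine hull F"
      using q F by (auto simp: generic_point_def)
    have "x + r *\<^sub>R (q - x) \<notin> affine hull F" if "r \<noteq> 0" for r
    proof
      assume "x + r *\<^sub>R (q - x) \<in> affine hull F"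
      from mem_affine[OF affine_affine_hull True this, of "1 - 1 / r" "1 / r"]
      have "(1 - 1 / r) *\<^sub>R x + (1 / r) *\<^sub>R (x + r *\<^sub>R (q - x)) \<in> affine hull F"
        by simp
      moreover have "(1 - 1 / r) *\<^sub>R x + (1 / r) *\<^sub>R (x + r *\<^sub>R (q - x)) = q"
        using that by (simp add: algebra_simps)
      ultimately show False
        using q' by simp
    qed
    then have "x + (t * \<sigma>) *\<^sub>R (q - x) \<notin> affine hull F" if "0 < t" for t
      using \<sigma> that by simp
    then show ?thesis
      by (auto simp: eventually_at_filter)
  next
    case False
    have "((\<lambda>t. x + (t * \<sigma>) *\<^sub>R (q - x)) \<longlongrightarrow> x + (0 * \<sigma>) *\<^sub>R (q - x)) (at_right 0)"
      by (intro tendsto_intros)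
    moreover have "open (- (affine hull F))"
      by (simp add: open_Compl affine_closed affine_affine_hull)
    ultimately show ?thesis
      using topological_tendstoD[of _ x "at_right 0" "- (affine hull F)"] False by simp
  qed
  then have "\<forall>\<^sub>F t in at_right 0. \<forall>F\<in>{F. F \<subseteq> V \<and> affine hull F \<noteq> UNIV}.
      x + (t * \<sigma>) *\<^sub>R (q - x) \<notin> affine hull F"
    by (intro eventually_ball_finite) (use V in auto)
  then show ?thesis
    by eventually_elim (auto simp: generic_point_def)
qed

lemma eventually_linear_nonneg_iff:
  fixes a d :: real
  shows "\<forall>\<^sub>F t in at_right 0. 0 \<le> a + t * d \<longleftrightarrow> 0 < a \<or> a = 0 \<and> 0 \<le> d"
proof -
  have lim: "((\<lambda>t. a + t * d) \<longlongrightarrow> a + 0 * d) (at_right 0)"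
    by (intro tendsto_intros)
  consider "0 < a" | "a < 0" | "a = 0"
    by linarith
  then show ?thesis
  proof cases
    case 1
    then have "\<forall>\<^sub>F t in at_right 0. 0 < a + t * d"
      using order_tendstoD(1)[OF lim, of 0] by simp
    then show ?thesis
      by eventually_elim (use 1 in auto)
  next
    case 2
    then have "\<forall>\<^sub>F t in at_right 0. a + t * d < 0"
      using order_tendstoD(2)[OF lim, of 0] by simp
    then show ?thesis
      by eventually_elim (use 2 in auto)
  next
    case 3
    have "\<forall>\<^sub>F t in at_right (0::real). 0 < t"
      by (simp add: eventually_at_filter)
    then show ?thesis
      by eventually_elim (use 3 in \<open>auto simp: zero_le_mult_iff\<close>)
  qed
qed

lemma card_lower_simplices_containing:
  fixes V :: "'a::euclidean_space set"
  assumes V: "finite V" and c: "generic_heights V c" and y: "generic_point V y"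
  shows "card {S\<in>lower_simplices V c. y \<in> convex hull S} = of_bool (y \<in> convex hull V)"
proof (cases "y \<in> convex hull V")
  case True
  then obtain S where S: "S \<in> lower_simplices V c" "y \<in> convex hull S"
    using lower_simplices_cover[OF V c y] by blast
  then have "{S\<in>lower_simplices V c. y \<in> convex hull S} = {S}"
    using lower_simplices_unique[OF y] by blast
  then show ?thesis
    using True by simp
next
  case False
  have "convex hull S \<subseteq> convex hull V" if "S \<in> lower_simplices V c" for S
    using that by (auto simp: lower_simplices_def intro: hull_mono[THEN subsetD])
  then have "{S\<in>lower_simplices V c. y \<in> convex hull S} = {}"
    using False by blast
  then show ?thesis
    using False by (simp del: Collect_empty_eq)
qed

text \<open>
  Moving \<open>x\<close> slightly towards \<open>q\<close> brings it into general position, hence into exactly one cell if it is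
  in the polytope; by the signs of the barycentric coordinates, the cell that is entered is the one whose
  half-open version, without the facets visible from \<open>q\<close>, contains \<open>x\<close>. Moving \<open>x\<close> slightly away from \<open>q\<close>
  keeps it in the polytope precisely when \<open>x\<close> is an interior point, and it enters the cell that contains \<open>x\<close>
  after removal of the complementary set of facets. So the same cells dissect the polytope and its interior,
  with complementary sets of facets removed.
\<close>

lemma
  fixes V :: "'a::euclidean_space set"
  assumes V: "finite V" and c: "generic_heights V c"
    and q: "generic_point V q" "q \<in> interior (convex hull V)"
  shows card_halfopen_containing:
      "card {S\<in>lower_simplices V c. x \<in> halfopen_simplex S (beyond S q)}
        = of_bool (x \<in> convex hull V)" (is ?closed)
    and card_complementary_halfopen_containing:
      "card {S\<in>lower_simplices V c. x \<in> halfopen_simplex S (S - beyond S q)}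
        = of_bool (x \<in> interior (convex hull V))" (is ?interior)
proof -
  let ?P = "convex hull V"
  \<comment> \<open>Both directions of motion at once: \<open>\<sigma>\<close> is \<open>1\<close> for the polytope and \<open>- 1\<close> for its interior.\<close>
  have count: "\<exists>t>0. t \<le> 1 \<and> R t \<and>
      card {S\<in>lower_simplices V c. \<forall>s\<in>S. 0 < bary S x s \<or> bary S x s = 0 \<and> 0 \<le> \<sigma> * bary S q s}
      = of_bool (x + (t * \<sigma>) *\<^sub>R (q - x) \<in> ?P)"
    if \<sigma>: "\<sigma> \<noteq> 0" and R: "\<forall>\<^sub>F t in at_right 0. R t" for \<sigma> and R :: "real \<Rightarrow> bool"
  proof -
    define y where "y t = x + (t * \<sigma>) *\<^sub>R (q - x)" for t
    have ev: "\<forall>\<^sub>F t in at_right 0. y t \<in> convex hull S \<longleftrightarrow>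
        (\<forall>s\<in>S. 0 < bary S x s \<or> bary S x s = 0 \<and> 0 \<le> \<sigma> * bary S q s)"
      if S: "S \<in> lower_simplices V c" for S
    proof -
      have bS: "affine_basis S" "finite S"
        using S by (auto simp: lower_simplices_def affine_basis_def)
      have "\<forall>\<^sub>F t in at_right 0. \<forall>s\<in>S. 0 \<le> bary S x s + t * (\<sigma> * (bary S q s - bary S x s)) \<longleftrightarrow>
          0 < bary S x s \<or> bary S x s = 0 \<and> 0 \<le> \<sigma> * (bary S q s - bary S x s)"
        by (intro eventually_ball_finite bS ballI eventually_linear_nonneg_iff)
      then show ?thesis
        by eventually_elim
           (auto simp: y_def mem_convex_hull_iff_bary[OF bS(1)] bary_affine[OF bS(1)] mult.assoc)
    qed
    have "\<forall>\<^sub>F t in at_right 0. \<forall>S\<in>lower_simplices V c. y t \<in> convex hull S \<longleftrightarrow>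
        (\<forall>s\<in>S. 0 < bary S x s \<or> bary S x s = 0 \<and> 0 \<le> \<sigma> * bary S q s)"
      by (intro eventually_ball_finite finite_lower_simplices V ballI ev)
    moreover have "\<forall>\<^sub>F t in at_right 0. generic_point V (y t)"
      unfolding y_def by (rule eventually_generic_point[OF V q(1) \<sigma>])
    moreover have "\<forall>\<^sub>F t in at_right (0::real). 0 < t \<and> t < 1"
      using eventually_at_right_real[of 0 "1::real"] by simp
    ultimately have "\<forall>\<^sub>F t in at_right 0. 0 < t \<and> t \<le> 1 \<and> R t \<and> generic_point V (y t) \<and>
        (\<forall>S\<in>lower_simplices V c. y t \<in> convex hull S \<longleftrightarrow>
          (\<forall>s\<in>S. 0 < bary S x s \<or> bary S x s = 0 \<and> 0 \<le> \<sigma> * bary S q s))"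
      using R by eventually_elim auto
    then obtain t where t: "0 < t" "t \<le> 1" "R t" "generic_point V (y t)"
      and eq: "\<And>S. S \<in> lower_simplices V c \<Longrightarrow> y t \<in> convex hull S \<longleftrightarrow>
          (\<forall>s\<in>S. 0 < bary S x s \<or> bary S x s = 0 \<and> 0 \<le> \<sigma> * bary S q s)"
      using eventually_happens'[OF trivial_limit_at_right_real] by blast
    have "{S\<in>lower_simplices V c. \<forall>s\<in>S. 0 < bary S x s \<or> bary S x s = 0 \<and> 0 \<le> \<sigma> * bary S q s}
        = {S\<in>lower_simplices V c. y t \<in> convex hull S}"
      using eq by auto
    then show ?thesis
      using card_lower_simplices_containing[OF V c t(4)] t by (auto simp: y_def)
  qed
  have nonzero: "bary S q s \<noteq> 0" if "S \<in> lower_simplices V c" "s \<in> S" for S s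
    using that generic_point_bary_nonzero[of S V q s] q(1) by (auto simp: lower_simplices_def)
  have lim: "((\<lambda>t. x + (t * \<sigma>) *\<^sub>R (q - x)) \<longlongrightarrow> x) (at_right 0)" for \<sigma> :: real
  proof -
    have "((\<lambda>t. x + (t * \<sigma>) *\<^sub>R (q - x)) \<longlongrightarrow> x + (0 * \<sigma>) *\<^sub>R (q - x)) (at_right 0)"
      by (intro tendsto_intros)
    then show ?thesis by simp
  qed
  have cP: "closed ?P"
    using V by (simp add: compact_imp_closed finite_imp_compact_convex_hull)
  show ?closed
  proof -
    have "\<forall>\<^sub>F t in at_right 0. x \<notin> ?P \<longrightarrow> x + (t * 1) *\<^sub>R (q - x) \<notin> ?P"
      using topological_tendstoD[OF lim[of 1], of "- ?P"] cP by (cases "x \<in> ?P") (auto simp: open_Compl)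
    from count[of 1, OF _ this] obtain t where t: "0 < t" "t \<le> 1"
        "x \<notin> ?P \<longrightarrow> x + (t * 1) *\<^sub>R (q - x) \<notin> ?P"
      and card: "card {S\<in>lower_simplices V c. \<forall>s\<in>S. 0 < bary S x s \<or> bary S x s = 0 \<and> 0 \<le> 1 * bary S q s}
        = of_bool (x + (t * 1) *\<^sub>R (q - x) \<in> ?P)"
      by auto
    have "x + t *\<^sub>R (q - x) \<in> ?P" if "x \<in> ?P"
    proof -
      have "(1 - t) *\<^sub>R x + t *\<^sub>R q \<in> ?P"
        using q(2) interior_subset[of ?P] that t by (intro convexD[OF convex_convex_hull]) auto
      then show ?thesis by (simp add: algebra_simps)
    qed
    then have "x + (t * 1) *\<^sub>R (q - x) \<in> ?P \<longleftrightarrow> x \<in> ?P"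
      using t by auto
    moreover have "{S\<in>lower_simplices V c. \<forall>s\<in>S. 0 < bary S x s \<or> bary S x s = 0 \<and> 0 \<le> 1 * bary S q s}
        = {S\<in>lower_simplices V c. x \<in> halfopen_simplex S (beyond S q)}"
    proof (intro Collect_cong conj_cong refl)
      fix S assume S: "S \<in> lower_simplices V c"
      have "(0 < bary S x s \<or> bary S x s = 0 \<and> 0 \<le> 1 * bary S q s) \<longleftrightarrow>
          (if s \<in> beyond S q then 0 < bary S x s else 0 \<le> bary S x s)" if "s \<in> S" for s
        using nonzero[OF S that] that by (auto simp: beyond_def)
      then show "(\<forall>s\<in>S. 0 < bary S x s \<or> bary S x s = 0 \<and> 0 \<le> 1 * bary S q s)
          \<longleftrightarrow> x \<in> halfopen_simplex S (beyond S q)"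
        by (simp add: halfopen_simplex_def)
    qed
    ultimately show ?closed
      using card by simp
  qed
  show ?interior
  proof -
    have "\<forall>\<^sub>F t in at_right 0. x \<in> interior ?P \<longrightarrow> x + (t * (- 1)) *\<^sub>R (q - x) \<in> ?P"
    proof (cases "x \<in> interior ?P")
      case True
      then have "\<forall>\<^sub>F t in at_right 0. x + (t * (- 1)) *\<^sub>R (q - x) \<in> interior ?P"
        using topological_tendstoD[OF lim[of "-1"], of "interior ?P"] by auto
      then show ?thesis
        by eventually_elim (use interior_subset in blast)
    qed simp
    from count[of "- 1", OF _ this] obtain t where t: "0 < t" "t \<le> 1"
        "x \<in> interior ?P \<longrightarrow> x + (t * (- 1)) *\<^sub>R (q - x) \<in> ?P"
      and card: "card {S\<in>lower_simplices V c. \<forall>s\<in>S. 0 < bary S x s \<or> bary S x s = 0 \<and> 0 \<le> (- 1) * bary S q s}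
        = of_bool (x + (t * (- 1)) *\<^sub>R (q - x) \<in> ?P)"
      by auto
    have "x \<in> interior ?P" if y: "x + (t * (- 1)) *\<^sub>R (q - x) \<in> ?P"
    proof -
      \<comment> \<open>\<open>x\<close> is a proper convex combination of \<open>y \<in> P\<close> and the interior point \<open>q\<close>.\<close>
      define y where "y = x - t *\<^sub>R (q - x)"
      have "y - (t / (1 + t)) *\<^sub>R (y - q) \<in> interior ?P"
        by (rule mem_interior_convex_shrink[OF convex_convex_hull q(2)])
           (use y t in \<open>auto simp: y_def field_simps\<close>)
      moreover have "y - q = (1 + t) *\<^sub>R (x - q)"
        by (simp add: y_def algebra_simps)
      then have "(t / (1 + t)) *\<^sub>R (y - q) = t *\<^sub>R (x - q)"
        using t by simp
      ultimately show ?thesis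
        by (simp add: y_def algebra_simps)
    qed
    then have "x + (t * (- 1)) *\<^sub>R (q - x) \<in> ?P \<longleftrightarrow> x \<in> interior ?P"
      using t by auto
    moreover have "{S\<in>lower_simplices V c. \<forall>s\<in>S. 0 < bary S x s \<or> bary S x s = 0 \<and> 0 \<le> (- 1) * bary S q s}
        = {S\<in>lower_simplices V c. x \<in> halfopen_simplex S (S - beyond S q)}"
    proof (intro Collect_cong conj_cong refl)
      fix S assume S: "S \<in> lower_simplices V c"
      have "(0 < bary S x s \<or> bary S x s = 0 \<and> 0 \<le> (- 1) * bary S q s) \<longleftrightarrow>
          (if s \<in> S - beyond S q then 0 < bary S x s else 0 \<le> bary S x s)" if "s \<in> S" for s
        using nonzero[OF S that] that by (auto simp: beyond_def)
      then show "(\<forall>s\<in>S. 0 < bary S x s \<or> bary S x s = 0 \<and> 0 \<le> (- 1) * bary S q s)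
          \<longleftrightarrow> x \<in> halfopen_simplex S (S - beyond S q)"
        by (simp add: halfopen_simplex_def)
    qed
    ultimately show ?interior
      using card by simp
  qed
qed

section \<open>The integer lattice\<close>

lemma int_lattice_zero [simp]: "0 \<in> int_lattice"
  by (simp add: int_lattice_def)

lemma int_lattice_add: "x \<in> int_lattice \<Longrightarrow> y \<in> int_lattice \<Longrightarrow> x + y \<in> int_lattice"
  by (simp add: int_lattice_def)

lemma int_lattice_minus: "x \<in> int_lattice \<Longrightarrow> - x \<in> int_lattice"
  by (simp add: int_lattice_def)

lemma int_lattice_diff: "x \<in> int_lattice \<Longrightarrow> y \<in> int_lattice \<Longrightarrow> x - y \<in> int_lattice"
  by (simp add: int_lattice_def)

lemma int_lattice_scaleR: "a \<in> \<int> \<Longrightarrow> x \<in> int_lattice \<Longrightarrow> a *\<^sub>R x \<in> int_lattice"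
  by (simp add: int_lattice_def)

lemma int_lattice_sum: "(\<And>i. i \<in> I \<Longrightarrow> f i \<in> int_lattice) \<Longrightarrow> sum f I \<in> int_lattice"
  by (induction I rule: infinite_finite_induct) (auto intro: int_lattice_add)

lemma finite_int_lattice_bounded:
  fixes B :: "(real ^ 'n) set"
  assumes "bounded B"
  shows "finite (B \<inter> int_lattice)"
proof -
  obtain a where a: "\<And>x. x \<in> B \<Longrightarrow> norm x \<le> a"
    using assms by (auto simp: bounded_iff)
  let ?I = "of_int ` {- \<lceil>a\<rceil>..\<lceil>a\<rceil>} :: real set"
  have "B \<inter> int_lattice \<subseteq> vec_lambda ` (UNIV \<rightarrow>\<^sub>E ?I)"
  proof
    fix x assume x: "x \<in> B \<inter> int_lattice"
    have "x $ i \<in> ?I" for i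
    proof -
      obtain m where m: "x $ i = of_int m"
        using x by (auto simp: int_lattice_def elim: Ints_cases)
      moreover have "\<bar>x $ i\<bar> \<le> a"
        using component_le_norm_cart[of x i] a[of x] x by auto
      ultimately have "\<bar>m\<bar> \<le> \<lceil>a\<rceil>"
        by (simp add: le_ceiling_iff ceiling_le_iff flip: of_int_abs)
      then show ?thesis
        using m by (auto simp: abs_le_iff intro!: image_eqI[of _ _ m])
    qed
    then show "x \<in> vec_lambda ` (UNIV \<rightarrow>\<^sub>E ?I)"
      by (intro image_eqI[of _ _ "vec_nth x"]) (auto simp: vec_nth_inverse)
  qed
  then show ?thesis
    by (rule finite_subset) (intro finite_imageI finite_PiE; simp)
qed

section \<open>Lattice points in dilated half-open simplices\<close>

definition compositions :: "'a set \<Rightarrow> nat \<Rightarrow> ('a \<Rightarrow> nat) set" where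
  "compositions S r = {m. (\<forall>s. s \<notin> S \<longrightarrow> m s = 0) \<and> sum m S = r}"

lemma card_compositions:
  assumes "card S = Suc n"
  shows "card (compositions S r) = (r + n choose n)"
proof -
  have "finite S"
    using assms card.infinite by fastforce
  then obtain xs where xs: "distinct xs" "set xs = S"
    using finite_distinct_list by blast
  have len: "length xs = Suc n"
    using assms xs distinct_card by fastforce
  have "bij_betw (\<lambda>m. map m xs) (compositions S r) {l. size l = Suc n \<and> sum_list l = r}"
  proof (rule bij_betwI')
    fix m m' assume "m \<in> compositions S r" "m' \<in> compositions S r"
    then show "map m xs = map m' xs \<longleftrightarrow> m = m'"
      using xs by (fastforce simp: compositions_def)
  next
    fix m assume "m \<in> compositions S r"
    then show "map m xs \<in> {l. size l = Suc n \<and> sum_list l = r}"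
      using xs len by (auto simp: compositions_def sum.distinct_set_conv_list)
  next
    fix l :: "nat list" assume l: "l \<in> {l. size l = Suc n \<and> sum_list l = r}"
    define m where "m s = (case map_of (zip xs l) s of Some y \<Rightarrow> y | None \<Rightarrow> 0)" for s
    have "map m xs = l"
      using l len xs by (intro nth_equalityI) (auto simp: m_def map_of_zip_nth)
    moreover have "m s = 0" if "s \<notin> S" for s
      using that xs l len by (auto simp: m_def split: option.split dest!: map_of_SomeD set_zip_leftD)
    ultimately show "\<exists>m\<in>compositions S r. l = map m xs"
      using l xs by (intro bexI[of _ m]) (auto simp: compositions_def sum.distinct_set_conv_list)
  qed
  then have "card (compositions S r) = (r + Suc n - 1 choose r)"
    using card_length_sum_list[of "Suc n" r] bij_betw_same_card by fastforce
  then show ?thesis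
    using binomial_symmetric[of r "r + n"] by simp
qed

text \<open>
  The lattice points of the dilate by \<open>k\<close> of the half-open simplex on \<open>S\<close> without the facets opposite to \<open>A\<close>,
  given by their homogeneous barycentric coordinates. In this form \<open>k = 0\<close> makes sense too: it
  describes the apex of the cone over the half-open simplex, present only if no facet is removed.
\<close>

definition cone_section :: "(real ^ 'n) set \<Rightarrow> (real ^ 'n) set \<Rightarrow> nat \<Rightarrow> (real ^ 'n \<Rightarrow> real) set" where
  "cone_section S A k = {l. (\<forall>s. s \<notin> S \<longrightarrow> l s = 0) \<and> (\<forall>s\<in>S. if s \<in> A then 0 < l s else 0 \<le> l s)
     \<and> sum l S = real k \<and> (\<Sum>s\<in>S. l s *\<^sub>R s) \<in> int_lattice}"

text \<open>
  The lattice points of the half-open fundamental parallelepiped of the cone over \<open>S\<close>. The facets to be removed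
  determine at which end each edge of the parallelepiped is open, so that every lattice point of the half-open cone is
  uniquely a point of the box plus a nonnegative integer combination of the generators.
\<close>

definition unit_box :: "(real ^ 'n) set \<Rightarrow> (real ^ 'n) set \<Rightarrow> (real ^ 'n \<Rightarrow> real) set" where
  "unit_box S A = {f. (\<forall>s. s \<notin> S \<longrightarrow> f s = 0)
     \<and> (\<forall>s\<in>S. if s \<in> A then 0 < f s \<and> f s \<le> 1 else 0 \<le> f s \<and> f s < 1)
     \<and> sum f S \<in> \<int> \<and> (\<Sum>s\<in>S. f s *\<^sub>R s) \<in> int_lattice}"

lemma cone_section_nonneg:
  assumes "l \<in> cone_section S A k" "s \<in> S"
  shows "0 \<le> l s"
proof -
  have "if s \<in> A then 0 < l s else 0 \<le> l s"
    using assms by (simp add: cone_section_def)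
  then show ?thesis
    by (simp split: if_splits)
qed

lemma unit_box_range:
  assumes "f \<in> unit_box S A" "s \<in> S"
  shows "0 \<le> f s" "f s \<le> 1" "s \<in> A \<Longrightarrow> 0 < f s" "s \<notin> A \<Longrightarrow> f s < 1"
proof -
  have "if s \<in> A then 0 < f s \<and> f s \<le> 1 else 0 \<le> f s \<and> f s < 1"
    using assms by (simp add: unit_box_def)
  then show "0 \<le> f s" "f s \<le> 1" "s \<in> A \<Longrightarrow> 0 < f s" "s \<notin> A \<Longrightarrow> f s < 1"
    by (simp_all split: if_splits)
qed

lemma inj_on_cone_section:
  fixes S :: "(real ^ 'n) set"
  assumes S: "affine_basis S"
  shows "inj_on (\<lambda>l. \<Sum>s\<in>S. l s *\<^sub>R s) (cone_section S A k)"
proof (rule inj_onI)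
  fix l l' assume l: "l \<in> cone_section S A k" "l' \<in> cone_section S A k"
    and eq: "(\<Sum>s\<in>S. l s *\<^sub>R s) = (\<Sum>s\<in>S. l' s *\<^sub>R s)"
  have "l s = l' s" for s
  proof (cases "s \<in> S")
    case True
    have "sum l S = sum l' S"
      using l by (simp add: cone_section_def)
    then show ?thesis
      using affine_basis_combination_unique[OF S _ eq True] by simp
  next
    case False
    then show ?thesis
      using l by (simp add: cone_section_def)
  qed
  then show "l = l'"
    by blast
qed

lemma finite_cone_section:
  fixes S :: "(real ^ 'n) set"
  assumes S: "affine_basis S"
  shows "finite (cone_section S A k)"
proof -
  let ?g = "\<lambda>l. \<Sum>s\<in>S. l s *\<^sub>R s"
  have fin: "finite S"
    using S by (simp add: affine_basis_def)
  have "inj_on ?g (cone_section S A k)"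
    by (rule inj_on_cone_section[OF S])
  moreover have "norm (?g l) \<le> (\<Sum>s\<in>S. real k * norm s)" if "l \<in> cone_section S A k" for l
  proof (rule sum_norm_le)
    fix s assume s: "s \<in> S"
    have nn: "0 \<le> l s" if "s \<in> S" for s
      by (rule cone_section_nonneg[OF \<open>l \<in> cone_section S A k\<close> that])
    have "l s \<le> sum l S"
      using fin s nn by (intro member_le_sum) auto
    then have "l s \<le> real k"
      using that by (simp add: cone_section_def)
    then show "norm (l s *\<^sub>R s) \<le> real k * norm s"
      using nn[OF s] by (simp add: mult_right_mono)
  qed
  then have "bounded (?g ` cone_section S A k)"
    unfolding bounded_iff by blast
  then have "finite (?g ` cone_section S A k \<inter> int_lattice)"
    by (rule finite_int_lattice_bounded)
  moreover have "?g ` cone_section S A k \<subseteq> int_lattice"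
    by (auto simp: cone_section_def)
  ultimately show ?thesis
    by (simp add: finite_image_iff Int_absorb2)
qed

lemma unit_box_sum_bounds:
  fixes S :: "(real ^ 'n) set"
  assumes "affine_basis S" "f \<in> unit_box S A"
  shows "0 \<le> sum f S" "sum f S \<le> 1 + real CARD('n)"
    and "A \<subset> S \<Longrightarrow> sum f S < 1 + real CARD('n)"
proof -
  have f: "0 \<le> f s" "f s \<le> 1" if "s \<in> S" for s
    using unit_box_range[OF assms(2) that] by auto
  have c: "real (card S) = 1 + real CARD('n)" and fin: "finite S"
    using card_affine_basis[OF assms(1)] assms(1) by (auto simp: affine_basis_def)
  show "0 \<le> sum f S"
    using f by (intro sum_nonneg)
  show "sum f S \<le> 1 + real CARD('n)"
    using sum_bounded_above[of S f 1] f c by simp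
  assume "A \<subset> S"
  then obtain s where "s \<in> S" "f s < 1"
    using unit_box_range(4)[OF assms(2)] by blast
  then have "sum f S < sum (\<lambda>_. 1) S"
    using f fin by (intro sum_strict_mono_ex1) auto
  then show "sum f S < 1 + real CARD('n)"
    using c by simp
qed

lemma finite_unit_box:
  fixes S :: "(real ^ 'n) set"
  assumes S: "affine_basis S"
  shows "finite (unit_box S A)"
proof -
  have "f \<in> (\<Union>k\<in>{..Suc CARD('n)}. cone_section S {} k)" if f: "f \<in> unit_box S A" for f
  proof -
    obtain j where j: "sum f S = of_int j"
      using f by (auto simp: unit_box_def elim: Ints_cases)
    have "0 \<le> j" "j \<le> 1 + int CARD('n)"
      using unit_box_sum_bounds[OF S f] j by linarith+
    then have "nat j \<le> Suc CARD('n)" "sum f S = real (nat j)"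
      using j by auto
    then have "f \<in> cone_section S {} (nat j)"
      using f unit_box_range(1)[OF f] by (simp add: unit_box_def cone_section_def)
    then show ?thesis
      using \<open>nat j \<le> Suc CARD('n)\<close> by blast
  qed
  then show ?thesis
    using finite_cone_section[OF S] finite_subset[of "unit_box S A" "\<Union>k\<in>{..Suc CARD('n)}. cone_section S {} k"]
    by blast
qed

text \<open>
  The point reflection of the parallelepiped interchanges the two ends of each edge. It is the source of
  the reciprocity law.
\<close>

lemma unit_box_reflect:
  fixes S :: "(real ^ 'n) set"
  assumes S: "S \<subseteq> int_lattice" and f: "f \<in> unit_box S A"
  shows "(\<lambda>s. if s \<in> S then 1 - f s else 0) \<in> unit_box S (S - A)"
proof -
  have "(\<Sum>s\<in>S. s) - (\<Sum>s\<in>S. f s *\<^sub>R s) \<in> int_lattice"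
  proof (rule int_lattice_diff)
    show "(\<Sum>s\<in>S. s) \<in> int_lattice"
      using S by (intro int_lattice_sum) auto
  qed (use f in \<open>simp add: unit_box_def\<close>)
  then have "(\<Sum>s\<in>S. (1 - f s) *\<^sub>R s) \<in> int_lattice"
    by (simp add: scaleR_left_diff_distrib sum_subtractf)
  moreover have "(\<Sum>s\<in>S. 1 - f s) \<in> \<int>"
    using f by (simp add: sum_subtractf unit_box_def)
  ultimately show ?thesis
    using f by (auto simp: unit_box_def cong: sum.cong split: if_splits)
qed

text \<open>
  Coordinates are split into a fractional part in \<open>unit_box S A\<close> and an integral part. For \<open>s \<in> A\<close> the
  fractional part is taken in \<open>{0<..1}\<close>, for the other vertices in \<open>{0..<1}\<close>.
\<close>

lemma card_cone_section:
  fixes S :: "(real ^ 'n) set"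
  assumes S: "affine_basis S" "S \<subseteq> int_lattice" and A: "A \<subseteq> S"
  shows "card (cone_section S A k)
    = (\<Sum>f\<in>unit_box S A. card {m. (\<forall>s. s \<notin> S \<longrightarrow> m s = 0) \<and> sum f S + real (sum m S) = real k})"
proof -
  let ?M = "\<lambda>f. {m :: real ^ 'n \<Rightarrow> nat. (\<forall>s. s \<notin> S \<longrightarrow> m s = 0) \<and> sum f S + real (sum m S) = real k}"
  let ?h = "\<lambda>(f, m) s. f s + real (m s :: nat)"
  have m_lattice: "(\<Sum>s\<in>S. real (m s) *\<^sub>R s) \<in> int_lattice" for m :: "real ^ 'n \<Rightarrow> nat"
    using S(2) by (intro int_lattice_sum int_lattice_scaleR) auto
  have "bij_betw ?h (SIGMA f:unit_box S A. ?M f) (cone_section S A k)"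
  proof (rule bij_betw_imageI)
    show "inj_on ?h (SIGMA f:unit_box S A. ?M f)"
    proof (rule inj_onI, clarify)
      fix f m f' m'
      assume f: "f \<in> unit_box S A" "f' \<in> unit_box S A" and m: "\<forall>s. s \<notin> S \<longrightarrow> m s = 0" "\<forall>s. s \<notin> S \<longrightarrow> m' s = 0"
        and eq: "(\<lambda>s. f s + real (m s :: nat)) = (\<lambda>s. f' s + real (m' s :: nat))"
      have "m s = m' s" for s
      proof (cases "s \<in> S")
        case True
        have e: "f s + real (m s) = f' s + real (m' s)"
          by (rule fun_cong[OF eq])
        have "if s \<in> A then 0 < f s \<and> f s \<le> 1 else 0 \<le> f s \<and> f s < 1"
             "if s \<in> A then 0 < f' s \<and> f' s \<le> 1 else 0 \<le> f' s \<and> f' s < 1"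
          using f True by (auto simp: unit_box_def)
        then have "\<bar>real (m s) - real (m' s)\<bar> < 1"
          using e by (auto split: if_splits)
        then show ?thesis
          by linarith
      qed (use m in simp)
      then show "f = f' \<and> m = m'"
        using fun_cong[OF eq] by (auto simp: fun_eq_iff)
    qed
    show "?h ` (SIGMA f:unit_box S A. ?M f) = cone_section S A k"
    proof (intro equalityI subsetI)
      fix l assume "l \<in> ?h ` (SIGMA f:unit_box S A. ?M f)"
      then obtain f m where f: "f \<in> unit_box S A" and m: "m \<in> ?M f" and l: "l = (\<lambda>s. f s + real (m s))"
        by auto
      have "(\<Sum>s\<in>S. f s *\<^sub>R s) + (\<Sum>s\<in>S. real (m s) *\<^sub>R s) \<in> int_lattice"
        using f m_lattice by (intro int_lattice_add) (simp_all add: unit_box_def)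
      then show "l \<in> cone_section S A k"
        using f m by (auto simp: l cone_section_def unit_box_def scaleR_left_distrib sum.distrib split: if_splits)
    next
      fix l assume l: "l \<in> cone_section S A k"
      define m where "m s = (if s \<in> A then nat (\<lceil>l s\<rceil> - 1) else nat \<lfloor>l s\<rfloor>)" for s
      define f where "f s = l s - real (m s)" for s
      have m0: "m s = 0" if "s \<notin> S" for s
        using that l A by (auto simp: m_def cone_section_def)
      have f0: "f s = 0" if "s \<notin> S" for s
        using that l m0 by (auto simp: f_def cone_section_def)
      have frange: "if s \<in> A then 0 < f s \<and> f s \<le> 1 else 0 \<le> f s \<and> f s < 1" if "s \<in> S" for s
      proof (cases "s \<in> A")
        case True
        then have "0 < l s"
          using l that by (auto simp: cone_section_def)
        then have "real (m s) = of_int \<lceil>l s\<rceil> - 1"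
          using True by (simp add: m_def)
        then show ?thesis
          using True by (simp add: f_def) linarith
      next
        case False
        then have "0 \<le> l s"
          using l that by (auto simp: cone_section_def)
        then have "real (m s) = of_int \<lfloor>l s\<rfloor>"
          using False by (simp add: m_def)
        then show ?thesis
          using False by (simp add: f_def) linarith
      qed
      have sumf: "sum f S = real k - real (sum m S)"
        using l by (simp add: f_def sum_subtractf cone_section_def)
      have "(\<Sum>s\<in>S. l s *\<^sub>R s) - (\<Sum>s\<in>S. real (m s) *\<^sub>R s) \<in> int_lattice"
        using l m_lattice by (intro int_lattice_diff) (simp_all add: cone_section_def)
      then have "(\<Sum>s\<in>S. f s *\<^sub>R s) \<in> int_lattice"
        by (simp add: f_def scaleR_left_diff_distrib sum_subtractf)
      moreover have "sum f S \<in> \<int>"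
        unfolding sumf by (intro Ints_diff Ints_of_nat)
      ultimately have "f \<in> unit_box S A"
        using f0 frange by (simp add: unit_box_def)
      moreover have "m \<in> ?M f"
        using m0 sumf by simp
      moreover have "l = ?h (f, m)"
        by (simp add: f_def)
      ultimately show "l \<in> ?h ` (SIGMA f:unit_box S A. ?M f)"
        by blast
    qed
  qed
  then have "card (cone_section S A k) = card (SIGMA f:unit_box S A. ?M f)"
    by (rule bij_betw_same_card[symmetric])
  also have "\<dots> = (\<Sum>f\<in>unit_box S A. card (?M f))"
  proof (rule card_SigmaI)
    show "\<forall>f\<in>unit_box S A. finite (?M f)"
    proof
      fix f
      have "?M f \<subseteq> compositions S (nat \<lfloor>real k - sum f S\<rfloor>)"
      proof
        fix m assume m: "m \<in> ?M f"
        then have "real k - sum f S = real (sum m S)"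
          by simp
        then have "nat \<lfloor>real k - sum f S\<rfloor> = sum m S"
          by (simp only: floor_of_nat nat_int)
        then show "m \<in> compositions S (nat \<lfloor>real k - sum f S\<rfloor>)"
          using m by (simp add: compositions_def)
      qed
      moreover have "finite (compositions S (nat \<lfloor>real k - sum f S\<rfloor>))"
        using card_compositions[of S "CARD('n)"] card_affine_basis[OF S(1)]
        by (intro card_ge_0_finite) simp
      ultimately show "finite (?M f)"
        by (rule finite_subset)
    qed
  qed (rule finite_unit_box[OF S(1)])
  finally show ?thesis .
qed

definition binomial_poly :: "nat \<Rightarrow> complex \<Rightarrow> complex poly" where
  "binomial_poly n a = smult (1 / fact n) (\<Prod>i<n. [:a - of_nat i, 1:])"

lemma poly_binomial_poly: "poly (binomial_poly n a) x = (x + a) gchoose n"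
  by (simp add: binomial_poly_def poly_prod gbinomial_prod_rev atLeast0LessThan algebra_simps)

lemma degree_binomial_poly: "degree (binomial_poly n a) \<le> n"
proof -
  have "degree (\<Prod>i<n. [:a - of_nat i, 1:]) \<le> (\<Sum>i<n. degree [:a - of_nat i, 1:])"
    by (rule order_trans[OF degree_prod_sum_le]) (auto simp: comp_def)
  then show ?thesis
    by (simp add: binomial_poly_def)
qed

text \<open>
  The term for \<open>f\<close> evaluates at \<open>k\<close> to \<open>(k - sum f S + n) gchoose n\<close>, where \<open>n = CARD('n)\<close>;
  this is the number of ways of distributing the remaining height \<open>k - sum f S\<close> over the \<open>n + 1\<close> generators.
\<close>

definition simplex_poly :: "(real ^ 'n) set \<Rightarrow> (real ^ 'n) set \<Rightarrow> complex poly" where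
  "simplex_poly S A = (\<Sum>f\<in>unit_box S A. binomial_poly CARD('n) (of_nat CARD('n) - of_real (sum f S)))"

lemma degree_simplex_poly:
  fixes S A :: "(real ^ 'n) set"
  shows "degree (simplex_poly S A) \<le> CARD('n)"
  unfolding simplex_poly_def
  by (cases "finite (unit_box S A)") (auto intro!: degree_sum_le degree_binomial_poly)

text \<open>
  The binomial coefficient polynomial also gives the right number, zero, if \<open>f\<close> lies above height \<open>k\<close>, as it vanishes at the arguments
  \<open>0, \<dots>, n - 1\<close>; by the bound on \<open>sum f S\<close>, only these occur when \<open>k \<ge> 1\<close>, or when some facet is kept.
\<close>

lemma poly_simplex_poly_of_nat:
  fixes S A :: "(real ^ 'n) set"
  assumes S: "affine_basis S" "S \<subseteq> int_lattice" and A: "A \<subseteq> S" and k: "k \<ge> 1 \<or> A \<noteq> S"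
  shows "poly (simplex_poly S A) (of_nat k) = of_nat (card (cone_section S A k))"
proof -
  have "of_nat k + (of_nat CARD('n) - of_real (sum f S)) gchoose CARD('n) =
      (of_nat (card {m. (\<forall>s. s \<notin> S \<longrightarrow> m s = 0) \<and> sum f S + real (sum m S) = real k}) :: complex)"
    (is "?g = of_nat (card ?M)")
    if f: "f \<in> unit_box S A" for f
  proof -
    obtain j where j: "sum f S = of_int j"
      using f by (auto simp: unit_box_def elim: Ints_cases)
    have jb: "0 \<le> j" "j \<le> int k + int CARD('n)"
    proof -
      have "A \<noteq> S \<Longrightarrow> A \<subset> S"
        using A by blast
      then show "0 \<le> j" "j \<le> int k + int CARD('n)"
        using unit_box_sum_bounds[OF S(1) f] k unfolding j by linarith+
    qed
    have "of_nat k + (of_nat CARD('n) - of_real (sum f S)) = (of_int (int k + int CARD('n) - j) :: complex)"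
      by (simp add: j)
    also have "\<dots> = of_nat (nat (int k + int CARD('n) - j))"
      using jb by (intro of_nat_nat[symmetric]) simp
    finally have g: "?g = of_nat (nat (int k + int CARD('n) - j)) gchoose CARD('n)"
      by (rule arg_cong)
    show ?thesis
    proof (cases "j \<le> int k")
      case True
      define r where "r = nat (int k - j)"
      have "?M = compositions S r"
        using True by (auto simp: compositions_def j r_def simp flip: of_nat_sum)
      moreover have "nat (int k + int CARD('n) - j) = r + CARD('n)"
        using True by (simp add: r_def nat_diff_distrib nat_add_distrib)
      moreover have "card (compositions S r) = (r + CARD('n) choose CARD('n))"
        using card_affine_basis[OF S(1)] by (intro card_compositions) simp
      ultimately show ?thesis
        unfolding g by (simp only: binomial_gbinomial)
    next
      case False
      then have "?M = {}"
        by (auto simp: j simp flip: of_nat_sum)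
      moreover have "nat (int k + int CARD('n) - j) < CARD('n)"
        using False jb by linarith
      ultimately show ?thesis
        unfolding g by (simp only: flip: binomial_gbinomial) (simp add: binomial_eq_0)
    qed
  qed
  then show ?thesis
    by (simp add: simplex_poly_def poly_sum poly_binomial_poly card_cone_section[OF S A])
qed

text \<open>
  Reciprocity for simplices: negating the argument turns \<open>sum f S\<close> into \<open>n + 1 - sum f S\<close> up to the
  sign in the negation rule for binomial coefficients, and this is the effect of the reflection of the box.
\<close>

lemma poly_simplex_poly_uminus:
  fixes S A :: "(real ^ 'n) set"
  assumes S: "affine_basis S" "S \<subseteq> int_lattice" and A: "A \<subseteq> S"
  shows "poly (simplex_poly S A) (- x) = (- 1) ^ CARD('n) * poly (simplex_poly S (S - A)) x"
proof -
  let ?r = "\<lambda>f s. if s \<in> S then 1 - f s else (0::real)"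
  let ?n = "of_nat CARD('n) :: complex"
  have rr: "?r (?r f) = f" if "f \<in> unit_box S B" for f B
    using that by (auto simp: unit_box_def fun_eq_iff)
  have c: "card S = Suc CARD('n)"
    using card_affine_basis[OF S(1)] by simp
  have "(- x + (?n - of_real (sum f S)) gchoose CARD('n))
      = (- 1) ^ CARD('n) * (x + (?n - of_real (sum (?r f) S)) gchoose CARD('n))" for f
  proof -
    have "sum (?r f) S = 1 + real CARD('n) - sum f S"
      using c by (simp add: sum_subtractf cong: sum.cong)
    moreover have "- x + (?n - of_real (sum f S)) = - (x - (?n - of_real (sum f S)))"
      by simp
    ultimately show ?thesis
      by (simp only: gbinomial_minus) (simp add: algebra_simps)
  qed
  then have "poly (simplex_poly S A) (- x)
      = (\<Sum>f\<in>unit_box S A. (- 1) ^ CARD('n) * (x + (?n - of_real (sum (?r f) S)) gchoose CARD('n)))"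
    by (simp add: simplex_poly_def poly_sum poly_binomial_poly)
  also have "\<dots> = (\<Sum>f\<in>unit_box S (S - A). (- 1) ^ CARD('n) * (x + (?n - of_real (sum f S)) gchoose CARD('n)))"
  proof (rule sum.reindex_bij_witness[where i = ?r and j = ?r])
    fix f assume "f \<in> unit_box S (S - A)"
    moreover have "S - (S - A) = A"
      using A by blast
    ultimately show "?r f \<in> unit_box S A"
      using unit_box_reflect[OF S(2), of f "S - A"] by simp
  qed (use unit_box_reflect[OF S(2)] rr in auto)
  finally show ?thesis
    by (simp add: simplex_poly_def poly_sum poly_binomial_poly sum_distrib_left)
qed

lemma card_scaled_halfopen:
  fixes S :: "(real ^ 'n) set"
  assumes S: "affine_basis S" and k: "k \<ge> 1"
  shows "card {x\<in>int_lattice. (1 / real k) *\<^sub>R x \<in> halfopen_simplex S A} = card (cone_section S A k)"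
proof -
  let ?g = "\<lambda>l. \<Sum>s\<in>S. l s *\<^sub>R s"
  have "bij_betw ?g (cone_section S A k) {x\<in>int_lattice. (1 / real k) *\<^sub>R x \<in> halfopen_simplex S A}"
  proof (rule bij_betw_imageI)
    show "inj_on ?g (cone_section S A k)"
      by (rule inj_on_cone_section[OF S])
    show "?g ` cone_section S A k = {x\<in>int_lattice. (1 / real k) *\<^sub>R x \<in> halfopen_simplex S A}"
    proof (intro equalityI subsetI)
      fix x assume "x \<in> ?g ` cone_section S A k"
      then obtain l where l: "l \<in> cone_section S A k" and x: "x = ?g l"
        by blast
      have "bary S ((1 / real k) *\<^sub>R x) s = l s / real k" if "s \<in> S" for s
      proof (rule bary_unique[OF S _ _ that])
        show "(\<Sum>s\<in>S. l s / real k) = 1"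
          using l k by (simp add: cone_section_def flip: sum_divide_distrib)
        show "(\<Sum>s\<in>S. (l s / real k) *\<^sub>R s) = (1 / real k) *\<^sub>R x"
          by (simp add: x scaleR_sum_right)
      qed
      then show "x \<in> {x\<in>int_lattice. (1 / real k) *\<^sub>R x \<in> halfopen_simplex S A}"
        using l k by (auto simp: halfopen_simplex_def cone_section_def x)
    next
      fix x assume x: "x \<in> {x\<in>int_lattice. (1 / real k) *\<^sub>R x \<in> halfopen_simplex S A}"
      define b where "b = bary S ((1 / real k) *\<^sub>R x)"
      define l where "l s = (if s \<in> S then real k * b s else 0)" for s
      have "?g l = real k *\<^sub>R (\<Sum>s\<in>S. b s *\<^sub>R s)"
        by (simp add: l_def scaleR_sum_right cong: sum.cong)
      then have gl: "?g l = x"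
        using k by (simp add: b_def sum_bary_scaleR[OF S])
      have "sum l S = real k * sum b S"
        by (simp add: l_def sum_distrib_left cong: sum.cong)
      then have "sum l S = real k"
        by (simp add: b_def sum_bary[OF S])
      moreover have "if s \<in> A then 0 < l s else 0 \<le> l s" if "s \<in> S" for s
        using x that k by (auto simp: l_def b_def halfopen_simplex_def)
      moreover have "\<forall>s. s \<notin> S \<longrightarrow> l s = 0"
        by (simp add: l_def)
      ultimately have "l \<in> cone_section S A k"
        using x gl by (simp add: cone_section_def)
      then show "x \<in> ?g ` cone_section S A k"
        using gl by blast
    qed
  qed
  then show ?thesis
    by (rule bij_betw_same_card[symmetric])
qed

lemma card_cone_section_0:
  fixes S :: "(real ^ 'n) set"
  assumes "finite S" "A \<subseteq> S"
  shows "card (cone_section S A 0) = of_bool (A = {})"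
proof -
  have "l = (\<lambda>_. 0)" if "l \<in> cone_section S A 0" for l
  proof -
    have "\<forall>s\<in>S. l s = 0"
      using that assms(1) cone_section_nonneg[OF that]
      by (subst sum_nonneg_eq_0_iff[symmetric]) (auto simp: cone_section_def)
    then show ?thesis
      using that by (auto simp: cone_section_def)
  qed
  moreover have "(\<lambda>_. 0) \<in> cone_section S A 0 \<longleftrightarrow> A = {}"
    using assms(2) by (auto simp: cone_section_def)
  ultimately have "cone_section S A 0 = (if A = {} then {\<lambda>_. 0} else {})"
    by auto
  then show ?thesis
    by simp
qed

section \<open>Ehrhart polynomials and reciprocity\<close>

lemma lattice_polytope_vertices:
  fixes P :: "(real ^ 'n) set"
  assumes "lattice_polytope P"
  shows "finite {v. v extreme_point_of P}"
    and "P = convex hull {v. v extreme_point_of P}"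
    and "{v. v extreme_point_of P} \<subseteq> int_lattice"
proof -
  have P: "polytope P"
    using assms by (simp add: lattice_polytope_def)
  show "finite {v. v extreme_point_of P}"
    by (rule finite_polyhedron_extreme_points[OF polytope_imp_polyhedron[OF P]])
  show "P = convex hull {v. v extreme_point_of P}"
    by (rule Krein_Milman_Minkowski[OF polytope_imp_compact[OF P] polytope_imp_convex[OF P]])
  show "{v. v extreme_point_of P} \<subseteq> int_lattice"
    using assms by (simp add: lattice_polytope_def)
qed

lemma interior_lattice_polytope_nonempty:
  fixes P :: "(real ^ 'n) set"
  assumes "lattice_polytope P"
  shows "interior P \<noteq> {}"
proof -
  have P: "polytope P" "aff_dim P = int DIM(real ^ 'n)"
    using assms by (simp_all add: lattice_polytope_def)
  then have "P \<noteq> {}"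
    by auto
  then have "rel_interior P \<noteq> {}"
    using rel_interior_eq_empty[OF polytope_imp_convex[OF P(1)]] by simp
  then show ?thesis
    using interior_rel_interior[OF P(2)] by simp
qed

text \<open>
  Ehrhart's theorem with Macdonald reciprocity, summed over the half-open cells of a regular dissection
  relative to a generic interior point \<open>q\<close>. The constant term counts the cells of which no facet is
  removed, and the only such cell is the one that contains \<open>q\<close>.
\<close>

theorem ehrhart_macdonald:
  fixes P :: "(real ^ 'n) set"
  assumes P: "lattice_polytope P"
  obtains G :: "complex poly" where
    "degree G \<le> CARD('n)"
    "\<And>k. k \<ge> 1 \<Longrightarrow> poly G (of_nat k) = of_nat (lattice_count ((*\<^sub>R) (real k) ` P))"
    "poly G 0 = 1"
    "\<And>k. k \<ge> 1 \<Longrightarrow>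
       poly G (- of_nat k) = (- 1) ^ CARD('n) * of_nat (lattice_count ((*\<^sub>R) (real k) ` interior P))"
proof -
  define V where "V = {v. v extreme_point_of P}"
  note V = lattice_polytope_vertices[OF P, folded V_def]
  obtain q where q: "q \<in> interior P" "generic_point V q"
    using generic_point_exists[OF V(1) open_interior interior_lattice_polytope_nonempty[OF P]] by blast
  obtain c where c: "generic_heights V c"
    using generic_heights_exist[OF V(1)] .
  let ?\<Sigma> = "lower_simplices V c"
  have cell: "affine_basis S" "finite S" "S \<subseteq> int_lattice" "beyond S q \<subseteq> S" "beyond S q \<noteq> S" if "S \<in> ?\<Sigma>" for S
  proof -
    show bS: "affine_basis S" "S \<subseteq> int_lattice" "beyond S q \<subseteq> S"
      using that V(3) by (auto simp: lower_simplices_def beyond_def)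
    then show "finite S"
      by (simp add: affine_basis_def)
    show "beyond S q \<noteq> S"
    proof
      assume "beyond S q = S"
      then have "sum (bary S q) S \<le> 0"
        by (intro sum_nonpos) (auto simp: beyond_def intro: less_imp_le)
      then show False
        using sum_bary[OF bS(1), of q] by simp
    qed
  qed
  have count: "lattice_count ((*\<^sub>R) (real k) ` R) = (\<Sum>S\<in>?\<Sigma>. card (cone_section S (A S) k))"
    if k: "k \<ge> 1" and R: "\<And>x. card {S\<in>?\<Sigma>. x \<in> halfopen_simplex S (A S)} = of_bool (x \<in> R)" "R \<subseteq> P"
    for k A R
  proof -
    let ?T = "(*\<^sub>R) (real k) ` R \<inter> int_lattice"
    have T: "x \<in> (*\<^sub>R) (real k) ` R \<longleftrightarrow> (1 / real k) *\<^sub>R x \<in> R" for x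
      using k by (auto intro!: image_eqI[of _ _ "(1 / real k) *\<^sub>R x"])
    have "bounded ((*\<^sub>R) (real k) ` R)"
      using R(2) V by (metis bounded_scaling bounded_subset finite_imp_bounded_convex_hull)
    then have finT: "finite ?T"
      by (rule finite_int_lattice_bounded)
    have "x \<in> R" if "S \<in> ?\<Sigma>" "x \<in> halfopen_simplex S (A S)" for S x
    proof -
      have "{S\<in>?\<Sigma>. x \<in> halfopen_simplex S (A S)} \<noteq> {}" "finite {S\<in>?\<Sigma>. x \<in> halfopen_simplex S (A S)}"
        using that finite_lower_simplices[OF V(1)] by auto
      then have "card {S\<in>?\<Sigma>. x \<in> halfopen_simplex S (A S)} \<noteq> 0"
        by simp
      then show ?thesis
        using R(1)[of x] by auto
    qed
    then have eqT: "{x\<in>?T. (1 / real k) *\<^sub>R x \<in> halfopen_simplex S (A S)}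
        = {x\<in>int_lattice. (1 / real k) *\<^sub>R x \<in> halfopen_simplex S (A S)}" if "S \<in> ?\<Sigma>" for S
      using that T by blast
    have "(\<Sum>S\<in>?\<Sigma>. card {x\<in>?T. (1 / real k) *\<^sub>R x \<in> halfopen_simplex S (A S)})
        = (\<Sum>S\<in>?\<Sigma>. card (cone_section S (A S) k))"
    proof (rule sum.cong[OF refl])
      fix S assume S: "S \<in> ?\<Sigma>"
      show "card {x\<in>?T. (1 / real k) *\<^sub>R x \<in> halfopen_simplex S (A S)} = card (cone_section S (A S) k)"
        unfolding eqT[OF S] by (rule card_scaled_halfopen[OF cell(1)[OF S] k])
    qed
    moreover have "(\<Sum>S\<in>?\<Sigma>. card {x\<in>?T. (1 / real k) *\<^sub>R x \<in> halfopen_simplex S (A S)}) = 1 * card ?T"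
      using T R(1) by (intro sum_multicount finite_lower_simplices V finT) auto
    ultimately show ?thesis
      by (simp add: lattice_count_def)
  qed
  note closed = card_halfopen_containing[OF V(1) c q(2) q(1)[unfolded V(2)], folded V(2)]
  note inner = card_complementary_halfopen_containing[OF V(1) c q(2) q(1)[unfolded V(2)], folded V(2)]
  define G where "G = (\<Sum>S\<in>?\<Sigma>. simplex_poly S (beyond S q))"
  show thesis
  proof
    show "degree G \<le> CARD('n)"
      unfolding G_def by (intro degree_sum_le degree_simplex_poly finite_lower_simplices V)
    show "poly G (of_nat k) = of_nat (lattice_count ((*\<^sub>R) (real k) ` P))" if "k \<ge> 1" for k
      using that cell by (simp add: G_def poly_sum poly_simplex_poly_of_nat count[OF that closed])
    have "poly (simplex_poly S (beyond S q)) 0 = of_bool (beyond S q = {})" if "S \<in> ?\<Sigma>" for S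
      using poly_simplex_poly_of_nat[OF cell(1,3,4)[OF that], of 0] cell(5)[OF that]
        card_cone_section_0[OF cell(2,4)[OF that]] by simp
    then have "poly G 0 = (\<Sum>S\<in>?\<Sigma>. of_bool (beyond S q = {}))"
      unfolding G_def poly_sum by (intro sum.cong) simp_all
    also have "\<dots> = of_nat (card {S\<in>?\<Sigma>. beyond S q = {}})"
      using finite_lower_simplices[OF V(1), of c] by (simp add: of_bool_def sum.If_cases Int_def)
    also have "{S\<in>?\<Sigma>. beyond S q = {}} = {S\<in>?\<Sigma>. q \<in> convex hull S}"
      using cell by (auto simp: beyond_def mem_convex_hull_iff_bary not_less)
    also have "card \<dots> = 1"
      using card_lower_simplices_containing[OF V(1) c q(2)] q(1) interior_subset V(2) by auto
    finally show "poly G 0 = 1"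
      by simp
    show "poly G (- of_nat k) = (- 1) ^ CARD('n) * of_nat (lattice_count ((*\<^sub>R) (real k) ` interior P))"
      if k: "k \<ge> 1" for k
    proof -
      have "poly G (- of_nat k) = (\<Sum>S\<in>?\<Sigma>. (- 1) ^ CARD('n) * poly (simplex_poly S (S - beyond S q)) (of_nat k))"
        using cell by (simp add: G_def poly_sum poly_simplex_poly_uminus)
      also have "\<dots> = (- 1) ^ CARD('n) * of_nat (\<Sum>S\<in>?\<Sigma>. card (cone_section S (S - beyond S q) k))"
        using cell k by (simp add: sum_distrib_left poly_simplex_poly_of_nat)
      also have "(\<Sum>S\<in>?\<Sigma>. card (cone_section S (S - beyond S q) k)) = lattice_count ((*\<^sub>R) (real k) ` interior P)"
        by (rule count[OF k inner interior_subset, symmetric])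
      finally show ?thesis .
    qed
  qed
qed

section \<open>Polynomials with all roots of real part minus one half\<close>

lemma poly_linear_factors_add_mset:
  "poly (\<Prod>y\<in>#add_mset x A. [:- y, 1:]) z = (z - x) * poly (\<Prod>y\<in>#A. [:- y, 1:]) (z :: 'a::comm_ring_1)"
  by (simp add: left_diff_distrib)

text \<open>
  Reflecting a real number \<open>r\<close> to \<open>- 1 - r\<close> in the line of real part \<open>- 1 / 2\<close> preserves its distance to every
  point of that line; and a point \<open>x\<close> of the line has \<open>1 \<le> 2 * cmod x\<close>, whence \<open>cmod (m - x) \<le> (1 + 2 * m) * cmod x\<close>.
\<close>

lemma
  fixes A :: "complex multiset"
  assumes "\<forall>x\<in>#A. Re x = - 1 / 2"
  shows cmod_linear_factors_reflect:
      "cmod (poly (\<Prod>x\<in>#A. [:- x, 1:]) (- 1 - of_real r)) = cmod (poly (\<Prod>x\<in>#A. [:- x, 1:]) (of_real r))"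
    and cmod_linear_factors_growth:
      "cmod (poly (\<Prod>x\<in>#A. [:- x, 1:]) (of_nat m))
        \<le> (1 + 2 * real m) ^ size A * cmod (poly (\<Prod>x\<in>#A. [:- x, 1:]) 0)"
proof -
  show "cmod (poly (\<Prod>x\<in>#A. [:- x, 1:]) (- 1 - of_real r)) = cmod (poly (\<Prod>x\<in>#A. [:- x, 1:]) (of_real r))"
    using assms
  proof (induction A)
    case (add x A)
    have "(- 1 / 2 - r)\<^sup>2 = (r + 1 / 2)\<^sup>2"
      by (simp add: power2_eq_square algebra_simps)
    then have "cmod (- 1 - of_real r - x) = cmod (of_real r - x)"
      using add.prems by (simp add: norm_complex_def)
    then show ?case
      using add by (simp only: poly_linear_factors_add_mset norm_mult) simp
  qed simp
  show "cmod (poly (\<Prod>x\<in>#A. [:- x, 1:]) (of_nat m))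
        \<le> (1 + 2 * real m) ^ size A * cmod (poly (\<Prod>x\<in>#A. [:- x, 1:]) 0)"
    using assms
  proof (induction A)
    case (add x A)
    have "1 / 2 \<le> cmod x"
      using abs_Re_le_cmod[of x] add.prems by simp
    then have "real m * 1 \<le> real m * (2 * cmod x)"
      by (intro mult_left_mono) auto
    then have "cmod (of_nat m - x) \<le> (1 + 2 * real m) * cmod x"
      using norm_triangle_ineq4[of "of_nat m" x] by (simp add: algebra_simps)
    moreover have "cmod (poly (\<Prod>x\<in>#A. [:- x, 1:]) (of_nat m))
        \<le> (1 + 2 * real m) ^ size A * cmod (poly (\<Prod>x\<in>#A. [:- x, 1:]) 0)"
      using add by simp
    ultimately have "cmod (of_nat m - x) * cmod (poly (\<Prod>x\<in>#A. [:- x, 1:]) (of_nat m))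
      \<le> ((1 + 2 * real m) * cmod x) * ((1 + 2 * real m) ^ size A * cmod (poly (\<Prod>x\<in>#A. [:- x, 1:]) 0))"
      by (intro mult_mono) auto
    then show ?case
      by (simp only: poly_linear_factors_add_mset norm_mult) (simp add: mult_ac)
  qed simp
qed

lemma
  fixes p :: "complex poly"
  assumes p: "p \<noteq> 0" and roots: "\<And>s. poly p s = 0 \<Longrightarrow> Re s = - 1 / 2"
  shows cmod_poly_reflect: "cmod (poly p (- 1 - of_real r)) = cmod (poly p (of_real r))"
    and cmod_poly_growth: "cmod (poly p (of_nat m)) \<le> (1 + 2 * real m) ^ degree p * cmod (poly p 0)"
proof -
  obtain A where A: "size A = degree p" and pA: "p = smult (lead_coeff p) (\<Prod>x\<in>#A. [:- x, 1:])"
    using alg_closed_imp_factorization[OF p] by blast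
  have eval: "poly p z = lead_coeff p * poly (\<Prod>x\<in>#A. [:- x, 1:]) z" for z
    by (subst pA) simp
  have "Re x = - 1 / 2" if "x \<in># A" for x
  proof -
    have "poly (\<Prod>x\<in>#A. [:- x, 1:]) x = 0"
      using that by (auto simp: poly_prod_mset prod_mset_zero_iff)
    then show ?thesis
      by (intro roots) (simp add: eval)
  qed
  then have A2: "\<forall>x\<in>#A. Re x = - 1 / 2"
    by blast
  show "cmod (poly p (- 1 - of_real r)) = cmod (poly p (of_real r))"
    by (simp only: eval norm_mult cmod_linear_factors_reflect[OF A2])
  show "cmod (poly p (of_nat m)) \<le> (1 + 2 * real m) ^ degree p * cmod (poly p 0)"
    using mult_left_mono[OF cmod_linear_factors_growth[OF A2, of m] norm_ge_zero[of "lead_coeff p"]]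
    by (simp only: eval norm_mult A mult_ac)
qed

text \<open>
  By reciprocity, interior lattice points of the dilate by \<open>k + 1\<close> are counted by the modulus of the Ehrhart
  polynomial at \<open>- 1 - k\<close>. A count is nonnegative, so it is determined by its modulus.
\<close>

lemma
  fixes P :: "(real ^ 'n) set"
  assumes P: "lattice_polytope P"
    and roots: "\<And>s :: complex. poly (ehrhart_poly P) s = 0 \<Longrightarrow> Re s = - 1 / 2"
  shows lattice_count_interior: "lattice_count (interior P) = 1"
    and lattice_count_interior_Suc: "k \<ge> 1 \<Longrightarrow>
      lattice_count ((*\<^sub>R) (real (Suc k)) ` interior P) = lattice_count ((*\<^sub>R) (real k) ` P)"
    and lattice_count_growth: "k \<ge> 1 \<Longrightarrow>
      real (lattice_count ((*\<^sub>R) (real k) ` P)) \<le> (1 + 2 * real k) ^ CARD('n)"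
proof -
  obtain G :: "complex poly" where deg: "degree G \<le> CARD('n)"
    and G: "\<And>k. k \<ge> 1 \<Longrightarrow> poly G (of_nat k) = of_nat (lattice_count ((*\<^sub>R) (real k) ` P))"
    and G0: "poly G 0 = 1"
    and Gneg: "\<And>k. k \<ge> 1 \<Longrightarrow>
       poly G (- of_nat k) = (- 1) ^ CARD('n) * of_nat (lattice_count ((*\<^sub>R) (real k) ` interior P))"
    using ehrhart_macdonald[OF P] by blast
  have "G \<noteq> 0"
    using G0 by auto
  moreover have "ehrhart_poly P = G"
    by (rule ehrhart_poly_eqI) (rule G)
  ultimately have reflect: "cmod (poly G (- 1 - of_real r)) = cmod (poly G (of_real r))"
    and growth: "cmod (poly G (of_nat m)) \<le> (1 + 2 * real m) ^ degree G * cmod (poly G 0)" for r m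
    using cmod_poly_reflect[of G r] cmod_poly_growth[of G m] roots by auto
  have int: "real (lattice_count ((*\<^sub>R) (real (Suc k)) ` interior P)) = cmod (poly G (of_nat k))" for k
  proof -
    have "- of_nat (Suc k) = (- 1 - of_real (real k) :: complex)"
      by simp
    then have "cmod (poly G (- of_nat (Suc k))) = cmod (poly G (of_nat k))"
      using reflect[of "real k"] by (simp only: of_real_of_nat_eq)
    then show ?thesis
      using Gneg[of "Suc k"] by (simp add: norm_mult norm_power)
  qed
  show "lattice_count (interior P) = 1"
    using int[of 0] G0 by simp
  show "lattice_count ((*\<^sub>R) (real (Suc k)) ` interior P) = lattice_count ((*\<^sub>R) (real k) ` P)" if "k \<ge> 1"
    using int[of k] G[OF that] by simp
  show "real (lattice_count ((*\<^sub>R) (real k) ` P)) \<le> (1 + 2 * real k) ^ CARD('n)" if "k \<ge> 1"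
  proof -
    have "real (lattice_count ((*\<^sub>R) (real k) ` P)) \<le> (1 + 2 * real k) ^ degree G"
      using growth[of k] G[OF that] G0 by simp
    also have "\<dots> \<le> (1 + 2 * real k) ^ CARD('n)"
      using deg by (intro power_increasing) auto
    finally show ?thesis .
  qed
qed

section \<open>The volume bound\<close>

text \<open>
  Rounding down moves a point of \<open>k P\<close> by a vector of the cube \<open>[-1, 0]\<^sup>n\<close>, which is contained in \<open>c P\<close> for large
  \<open>c\<close>. Hence the unit cubes at the lattice points of \<open>(k + c) P\<close> cover \<open>k P\<close>.
\<close>

lemma lattice_count_ge_volume:
  fixes P :: "(real ^ 'n) set"
  assumes P: "compact P" "convex P" and zero: "0 \<in> interior P"
  obtains c :: nat where
    "\<And>k. k \<ge> 1 \<Longrightarrow> real k ^ CARD('n) * measure lebesgue P \<le> lattice_count ((*\<^sub>R) (real (k + c)) ` P)"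
proof -
  obtain e where e: "0 < e" "cball 0 e \<subseteq> P"
    using zero by (meson mem_interior_cball)
  obtain c :: nat where c: "real CARD('n) / e < real c"
    using reals_Archimedean2 by blast
  have c0: "0 < real c"
    using c e by (meson divide_nonneg_pos le_less_trans of_nat_0_le_iff)
  have unit: "u \<in> (*\<^sub>R) (real c) ` P" if "\<And>i. \<bar>u $ i\<bar> \<le> 1" for u
  proof (rule image_eqI)
    have "norm u \<le> (\<Sum>i\<in>UNIV. \<bar>u $ i\<bar>)"
      by (rule norm_le_l1_cart)
    also have "\<dots> \<le> (\<Sum>i\<in>(UNIV :: 'n set). 1)"
      using that by (intro sum_mono)
    finally have "norm u \<le> real CARD('n)"
      by simp
    also have "\<dots> \<le> e * real c"
      using c e(1) by (simp add: pos_divide_less_eq mult.commute)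
    finally have "norm ((1 / real c) *\<^sub>R u) \<le> e"
      using c0 by (simp add: pos_divide_le_eq)
    then show "(1 / real c) *\<^sub>R u \<in> P"
      using e(2) by auto
    show "u = real c *\<^sub>R ((1 / real c) *\<^sub>R u)"
      using c0 by simp
  qed
  have "real k ^ CARD('n) * measure lebesgue P \<le> lattice_count ((*\<^sub>R) (real (k + c)) ` P)"
    if k: "k \<ge> 1" for k
  proof -
    let ?kP = "(*\<^sub>R) (real k) ` P"
    let ?Z = "(*\<^sub>R) (real (k + c)) ` P \<inter> int_lattice"
    have "finite ?Z"
      using compact_imp_bounded[OF P(1)] by (intro finite_int_lattice_bounded bounded_scaling)
    have "?kP \<subseteq> (\<Union>z\<in>?Z. cbox z (z + 1))"
    proof
      fix x assume "x \<in> ?kP"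
      then obtain p where p: "p \<in> P" "x = real k *\<^sub>R p"
        by blast
      define z :: "real ^ 'n" where "z = (\<chi> i. of_int \<lfloor>x $ i\<rfloor>)"
      have frac: "of_int \<lfloor>x $ i\<rfloor> \<le> x $ i" "x $ i \<le> of_int \<lfloor>x $ i\<rfloor> + 1" for i
        by linarith+
      have "\<bar>(z - x) $ i\<bar> \<le> 1" for i
        using frac[of i] unfolding z_def vector_minus_component vec_lambda_beta by linarith
      then obtain p' where p': "p' \<in> P" "z - x = real c *\<^sub>R p'"
        using unit[of "z - x"] by blast
      have "(real k / real (k + c)) *\<^sub>R p + (real c / real (k + c)) *\<^sub>R p' \<in> P"
        using p p' k by (intro convexD[OF P(2)]) (auto simp flip: add_divide_distrib)
      moreover have "z = real (k + c) *\<^sub>R ((real k / real (k + c)) *\<^sub>R p + (real c / real (k + c)) *\<^sub>R p')"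
      proof -
        have "z = real k *\<^sub>R p + real c *\<^sub>R p'"
          using p p' by (simp flip: p'(2))
        then show ?thesis
          using k by (simp add: scaleR_right_distrib del: of_nat_add)
      qed
      ultimately have "z \<in> (*\<^sub>R) (real (k + c)) ` P"
        by blast
      moreover have "z \<in> int_lattice"
        by (simp add: z_def int_lattice_def)
      moreover have "x \<in> cbox z (z + 1)"
        using frac by (simp add: mem_box_cart z_def)
      ultimately show "x \<in> (\<Union>z\<in>?Z. cbox z (z + 1))"
        by blast
    qed
    then have "measure lebesgue ?kP \<le> measure lebesgue (\<Union>z\<in>?Z. cbox z (z + 1))"
      using \<open>finite ?Z\<close> P(1)
      by (intro measure_mono_fmeasurable) (auto intro!: fmeasurable.finite_UN lmeasurable_compact compact_scaling fmeasurableD)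
    also have "\<dots> \<le> (\<Sum>z\<in>?Z. measure lebesgue (cbox z (z + 1)))"
      using \<open>finite ?Z\<close> by (intro measure_UNION_le) auto
    also have "\<dots> = (\<Sum>z\<in>?Z. 1)"
    proof (rule sum.cong[OF refl])
      fix z :: "real ^ 'n"
      have "z \<in> cbox z (z + 1)"
        by (simp add: mem_box_cart)
      then have "measure lborel (cbox z (z + 1)) = 1"
        by (subst content_cbox_cart) auto
      then show "measure lebesgue (cbox z (z + 1)) = 1"
        by simp
    qed
    also have "\<dots> = lattice_count ((*\<^sub>R) (real (k + c)) ` P)"
      by (simp add: lattice_count_def)
    finally show ?thesis
      using measure_lebesgue_affine[of "real k" "0 :: real ^ 'n" P] by simp
  qed
  then show thesis
    using that by blast
qed

text \<open>
  Dividing \<open>k ^ n * vol P \<le> (1 + 2 * (k + c)) ^ n\<close> by \<open>k ^ n\<close> and letting \<open>k\<close> grow leaves \<open>2 ^ n\<close> on the right.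
\<close>

lemma volume_le_two_power:
  fixes P :: "(real ^ 'n) set"
  assumes P: "compact P" "convex P" "0 \<in> interior P"
    and growth: "\<And>k. k \<ge> 1 \<Longrightarrow> real (lattice_count ((*\<^sub>R) (real k) ` P)) \<le> (1 + 2 * real k) ^ CARD('n)"
  shows "measure lebesgue P \<le> 2 ^ CARD('n)"
proof -
  obtain c where c: "\<And>k. k \<ge> 1 \<Longrightarrow>
      real k ^ CARD('n) * measure lebesgue P \<le> lattice_count ((*\<^sub>R) (real (k + c)) ` P)"
    using lattice_count_ge_volume[OF P] by blast
  have "measure lebesgue P \<le> (2 + (1 + 2 * real c) / real k) ^ CARD('n)" if k: "k \<ge> 1" for k
  proof -
    have "real k ^ CARD('n) * measure lebesgue P \<le> (1 + 2 * real (k + c)) ^ CARD('n)"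
      using c[OF k] growth[of "k + c"] k by simp
    also have "1 + 2 * real (k + c) = real k * (2 + (1 + 2 * real c) / real k)"
      using k by (simp add: field_simps)
    also have "\<dots> ^ CARD('n) = real k ^ CARD('n) * (2 + (1 + 2 * real c) / real k) ^ CARD('n)"
      by (rule power_mult_distrib)
    finally show ?thesis
      by (rule mult_left_le_imp_le) (use k in simp)
  qed
  moreover have "(\<lambda>k. (2 + (1 + 2 * real c) / real k) ^ CARD('n)) \<longlonglongrightarrow> (2 + 0) ^ CARD('n)"
    by (intro tendsto_intros lim_const_over_n)
  ultimately have "measure lebesgue P \<le> (2 + 0) ^ CARD('n)"
    by (intro LIMSEQ_le_const) auto
  then show ?thesis
    by simp
qed

section \<open>Integrality of the polar\<close>

text \<open>
  If the tight constraints at \<open>y\<close> did not span the space, then \<open>y\<close> could be moved both ways along a vector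
  orthogonal to all of them.
\<close>

lemma extreme_point_polar_span:
  fixes V :: "'a::euclidean_space set"
  assumes V: "finite V" and y: "y extreme_point_of {y. \<forall>v\<in>V. v \<bullet> y \<le> 1}"
  shows "span {v\<in>V. v \<bullet> y = 1} = UNIV"
proof (rule ccontr)
  let ?T = "{v\<in>V. v \<bullet> y = 1}"
  let ?Q = "{y. \<forall>v\<in>V. v \<bullet> y \<le> 1}"
  assume "span ?T \<noteq> UNIV"
  then have "dim ?T < DIM('a)"
    using dim_eq_full[of ?T] dim_subset_UNIV[of ?T] by linarith
  then obtain d where d: "d \<noteq> 0" "\<And>v. v \<in> span ?T \<Longrightarrow> orthogonal d v"
    using orthogonal_to_subspace_exists by blast
  have yQ: "v \<bullet> y \<le> 1" if "v \<in> V" for v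
    using y that by (auto simp: extreme_point_of_def)
  have dT: "v \<bullet> d = 0" if "v \<in> V" "v \<bullet> y = 1" for v
    using d(2)[of v] that by (auto simp: orthogonal_def inner_commute intro: span_base)
  have "\<forall>\<^sub>F t in at_right 0. \<forall>v\<in>V. 0 \<le> (1 - v \<bullet> y) + t * (- (v \<bullet> d)) \<and> 0 \<le> (1 - v \<bullet> y) + t * (v \<bullet> d)"
  proof (rule eventually_ball_finite[OF V], rule ballI)
    fix v assume v: "v \<in> V"
    have "0 < 1 - v \<bullet> y \<or> 1 - v \<bullet> y = 0 \<and> v \<bullet> d = 0"
      using yQ[OF v] dT[OF v] by linarith
    then show "\<forall>\<^sub>F t in at_right 0. 0 \<le> (1 - v \<bullet> y) + t * (- (v \<bullet> d)) \<and> 0 \<le> (1 - v \<bullet> y) + t * (v \<bullet> d)"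
      using eventually_conj[OF eventually_linear_nonneg_iff[of "1 - v \<bullet> y" "- (v \<bullet> d)"]
        eventually_linear_nonneg_iff[of "1 - v \<bullet> y" "v \<bullet> d"]]
      by (auto elim: eventually_mono)
  qed
  moreover have "\<forall>\<^sub>F t in at_right (0::real). 0 < t"
    by (rule eventually_at_right_less)
  ultimately have "\<forall>\<^sub>F t in at_right 0. 0 < t \<and>
      (\<forall>v\<in>V. 0 \<le> (1 - v \<bullet> y) + t * (- (v \<bullet> d)) \<and> 0 \<le> (1 - v \<bullet> y) + t * (v \<bullet> d))"
    by eventually_elim simp
  then obtain t where t: "0 < t"
    and tV: "\<And>v. v \<in> V \<Longrightarrow> 0 \<le> (1 - v \<bullet> y) + t * (- (v \<bullet> d)) \<and> 0 \<le> (1 - v \<bullet> y) + t * (v \<bullet> d)"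
    using eventually_happens'[OF trivial_limit_at_right_real] by blast
  have "y + t *\<^sub>R d \<in> ?Q" "y - t *\<^sub>R d \<in> ?Q"
    using tV by (fastforce simp: inner_add_right inner_diff_right)+
  then have "y \<notin> open_segment (y + t *\<^sub>R d) (y - t *\<^sub>R d)"
    using y by (auto simp: extreme_point_of_def)
  moreover have "y = midpoint (y + t *\<^sub>R d) (y - t *\<^sub>R d)"
    by (simp add: midpoint_def)
  moreover have "y + t *\<^sub>R d \<noteq> y - t *\<^sub>R d"
  proof
    assume "y + t *\<^sub>R d = y - t *\<^sub>R d"
    then have "(2 * t) *\<^sub>R d = 0"
      by (simp add: algebra_simps scaleR_2 flip: scaleR_scaleR)
    then show False
      using t d(1) by simp
  qed
  ultimately show False
    by (metis midpoint_in_open_segment)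
qed

text \<open>
  The hypothesis \<open>shells\<close> says that no lattice point lies strictly between the boundaries of \<open>k P\<close> and
  \<open>(k + 1) P\<close>. A vertex \<open>y\<close> of the polar corresponds to a facet of \<open>P\<close>, with \<open>x \<bullet> y = r\<close> on
  the boundary of \<open>r P\<close> in the cone over this facet. Any lattice point can be moved into that cone by
  adding a multiple of the sum of the facet's vertices, which changes its product with \<open>y\<close> by an integer;
  inside the cone, the hypothesis makes the product an integer. So \<open>y\<close> has integral products with
  all lattice points.
\<close>

lemma lattice_polytope_polar:
  fixes P :: "(real ^ 'n) set"
  assumes P: "lattice_polytope P" and zero: "0 \<in> interior P"
    and shells: "\<And>k. (*\<^sub>R) (real (Suc k)) ` interior P \<inter> int_lattice \<subseteq> (*\<^sub>R) (real k) ` P"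
  shows "lattice_polytope (polar P)"
proof -
  define V where "V = {v. v extreme_point_of P}"
  note V = lattice_polytope_vertices[OF P, folded V_def]
  have P': "compact P" "convex P"
    using P by (simp_all add: lattice_polytope_def polytope_imp_compact polytope_imp_convex)
  have polar: "polar P = {y. \<forall>v\<in>V. v \<bullet> y \<le> 1}"
  proof (intro equalityI subsetI)
    fix y assume "y \<in> polar P"
    then show "y \<in> {y. \<forall>v\<in>V. v \<bullet> y \<le> 1}"
      using hull_subset[of V convex] V(2) by (auto simp: polar_def)
  next
    fix y assume y: "y \<in> {y. \<forall>v\<in>V. v \<bullet> y \<le> 1}"
    have "convex hull V \<subseteq> {x. y \<bullet> x \<le> 1}"
      using y by (intro hull_minimal convex_halfspace_le) (auto simp: inner_commute)
    then show "y \<in> polar P"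
      using V(2) by (auto simp: polar_def inner_commute)
  qed
  have "polytope (polar P)"
    unfolding polytope_eq_bounded_polyhedron
  proof
    have "{y. \<forall>v\<in>V. v \<bullet> y \<le> 1} = \<Inter>((\<lambda>v. {y. v \<bullet> y \<le> 1}) ` V)"
      by auto
    then show "polyhedron (polar P)"
      unfolding polar using V(1) by (auto intro!: polyhedron_Inter polyhedron_halfspace_le)
    obtain e where e: "0 < e" "cball 0 e \<subseteq> P"
      using zero by (meson mem_interior_cball)
    have "norm y \<le> 1 / e" if y: "y \<in> polar P" for y
    proof (cases "y = 0")
      case False
      have "(e / norm y) *\<^sub>R y \<in> P"
        using e False by (intro subsetD[OF e(2)]) auto
      then have "((e / norm y) *\<^sub>R y) \<bullet> y \<le> 1"
        using y by (auto simp: polar_def)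
      then have "e * norm y \<le> 1"
        using False by (simp add: power2_norm_eq_inner[symmetric] power2_eq_square)
      then show ?thesis
        using e by (simp add: field_simps)
    qed (use e in simp)
    then show "bounded (polar P)"
      unfolding bounded_iff by blast
  qed
  moreover have "aff_dim (polar P) = int CARD('n)"
  proof -
    obtain b where b: "0 < b" "\<And>x. x \<in> P \<Longrightarrow> norm x \<le> b"
      using compact_imp_bounded[OF P'(1)] by (auto simp: bounded_pos)
    have "cball 0 (1 / b) \<subseteq> polar P"
    proof
      fix y :: "real ^ 'n" assume y: "y \<in> cball 0 (1 / b)"
      have "x \<bullet> y \<le> 1" if "x \<in> P" for x
      proof -
        have "x \<bullet> y \<le> norm x * norm y"
          by (rule norm_cauchy_schwarz)
        also have "\<dots> \<le> b * (1 / b)"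
          using y b that by (intro mult_mono) auto
        finally show ?thesis
          using b by simp
      qed
      then show "y \<in> polar P"
        by (simp add: polar_def)
    qed
    then have "0 \<in> interior (polar P)"
      using b(1) unfolding mem_interior_cball by (intro exI[of _ "1 / b"]) auto
    then have "affine hull (polar P) = UNIV"
      by (intro affine_hull_nonempty_interior) auto
    then have "aff_dim (polar P) = int DIM(real ^ 'n)"
      unfolding aff_dim_eq_full .
    then show ?thesis
      by simp
  qed
  moreover have "y \<in> int_lattice" if y: "y extreme_point_of (polar P)" for y
  proof -
    define T where "T = {v\<in>V. v \<bullet> y = 1}"
    have T: "finite T" "T \<subseteq> P" "T \<subseteq> int_lattice" "\<And>v. v \<in> T \<Longrightarrow> v \<bullet> y = 1"
      using V hull_subset[of V convex] by (auto simp: T_def)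
    have spanT: "span T = UNIV"
      unfolding T_def using extreme_point_polar_span[OF V(1)] y unfolding polar by blast
    have yP: "x \<bullet> y \<le> 1" if "x \<in> P" for x
      using y that by (auto simp: extreme_point_of_def polar_def)
    have integral: "x \<bullet> y \<in> \<int>" if x: "x \<in> int_lattice" for x
    proof -
      obtain \<beta> where \<beta>: "x = (\<Sum>v\<in>T. \<beta> v *\<^sub>R v)"
        using span_finite[OF T(1)] spanT by blast
      obtain N :: nat where N: "(\<Sum>v\<in>T. \<bar>\<beta> v\<bar>) < real N"
        using reals_Archimedean2 by blast
      \<comment> \<open>The choice of \<open>N\<close> moves \<open>x\<close> into the cone over the tight vertices.\<close>
      define z where "z = x + real N *\<^sub>R (\<Sum>v\<in>T. v)"
      define \<gamma> where "\<gamma> v = real N + \<beta> v" for v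
      define r where "r = sum \<gamma> T"
      have \<gamma>_pos: "0 \<le> \<gamma> v" if "v \<in> T" for v
        using member_le_sum[OF that _ T(1), of "\<lambda>v. \<bar>\<beta> v\<bar>"] N by (simp add: \<gamma>_def)
      have z_eq: "z = (\<Sum>v\<in>T. \<gamma> v *\<^sub>R v)"
        by (simp add: z_def \<beta> \<gamma>_def scaleR_left_distrib sum.distrib scaleR_sum_right)
      have zL: "z \<in> int_lattice"
        unfolding z_def using x T(3) by (intro int_lattice_add int_lattice_scaleR int_lattice_sum) auto
      have zy: "z \<bullet> y = r"
        using T(4) by (simp add: z_eq r_def inner_sum_left)
      have r0: "0 \<le> r"
        unfolding r_def by (intro sum_nonneg \<gamma>_pos)
      have "r \<in> \<int>"
      proof (rule ccontr)
        assume r: "r \<notin> \<int>"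
        \<comment> \<open>Otherwise \<open>z\<close> is a lattice point strictly between the boundaries of \<open>k P\<close> and \<open>(k + 1) P\<close>.\<close>
        define k where "k = nat \<lfloor>r\<rfloor>"
        have k_eq: "real k = of_int \<lfloor>r\<rfloor>"
          using r0 by (simp add: k_def)
        moreover have "r \<noteq> of_int \<lfloor>r\<rfloor>"
          using r by (metis Ints_of_int)
        ultimately have k: "real k < r" "r < real (Suc k)"
          by simp_all linarith+
        have r_pos: "0 < r"
          using k(1) by (meson le_less_trans of_nat_0_le_iff)
        define p where "p = (\<Sum>v\<in>T. (\<gamma> v / r) *\<^sub>R v)"
        have "p \<in> P"
          unfolding p_def
        proof (rule convex_sum[OF T(1) P'(2)])
          show "(\<Sum>v\<in>T. \<gamma> v / r) = 1"
            using r_pos by (simp add: r_def flip: sum_divide_distrib)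
        qed (use T(2) \<gamma>_pos r_pos in auto)
        then have "p - (1 - r / real (Suc k)) *\<^sub>R (p - 0) \<in> interior P"
          using r_pos k(2) by (intro mem_interior_convex_shrink[OF P'(2) zero]) auto
        moreover have "p - (1 - r / real (Suc k)) *\<^sub>R (p - 0) = (r / real (Suc k)) *\<^sub>R p"
          by (simp add: scaleR_left_diff_distrib)
        moreover have zp: "z = r *\<^sub>R p"
          using r_pos by (simp add: z_eq p_def scaleR_sum_right)
        ultimately have "z \<in> (*\<^sub>R) (real (Suc k)) ` interior P"
          by (intro image_eqI[of _ _ "(r / real (Suc k)) *\<^sub>R p"]) (simp_all del: of_nat_Suc)
        then obtain p' where "p' \<in> P" "z = real k *\<^sub>R p'"
          using shells[of k] zL by blast
        then have "r \<le> real k"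
          using yP[of p'] zy mult_left_le[of "p' \<bullet> y" "real k"] by simp
        then show False
          using k(1) by simp
      qed
      moreover have "z \<bullet> y = x \<bullet> y + real N * real (card T)"
        using T(4) by (simp add: z_def inner_add_left inner_sum_left)
      ultimately have "x \<bullet> y = r - real N * real (card T)"
        using zy by simp
      then show ?thesis
        using \<open>r \<in> \<int>\<close> by simp
    qed
    have "y $ i \<in> \<int>" for i
    proof -
      have "axis i 1 \<in> (int_lattice :: (real ^ 'n) set)"
        by (simp add: int_lattice_def axis_def)
      from integral[OF this] show ?thesis
        by (simp add: inner_axis inner_commute)
    qed
    then show ?thesis
      by (simp add: int_lattice_def)
  qed
  ultimately show ?thesis
    by (auto simp: lattice_polytope_def)
qed

section \<open>Translation to the interior lattice point\<close>

lemma lattice_count_translation: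
  assumes "t \<in> int_lattice"
  shows "lattice_count ((+) t ` S) = lattice_count S"
proof -
  have "t + x \<in> int_lattice \<longleftrightarrow> x \<in> int_lattice" for x
    using int_lattice_add[OF assms, of x] int_lattice_diff[OF _ assms, of "t + x"] by auto
  then have "(+) t ` S \<inter> int_lattice = (+) t ` (S \<inter> int_lattice)"
    by auto
  then show ?thesis
    by (simp add: lattice_count_def card_image)
qed

lemma ehrhart_poly_translation:
  assumes "t \<in> int_lattice"
  shows "ehrhart_poly ((+) t ` P) = ehrhart_poly P"
proof -
  have "(*\<^sub>R) (real k) ` (+) t ` P = (+) (real k *\<^sub>R t) ` (*\<^sub>R) (real k) ` P" for k
    by (simp add: image_image scaleR_right_distrib)
  then have "lattice_count ((*\<^sub>R) (real k) ` (+) t ` P) = lattice_count ((*\<^sub>R) (real k) ` P)" for k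
    using assms by (simp add: lattice_count_translation int_lattice_scaleR)
  then show ?thesis
    by (simp add: ehrhart_poly_def)
qed

lemma lattice_polytope_translation:
  fixes P :: "(real ^ 'n) set"
  assumes "lattice_polytope P" "t \<in> int_lattice"
  shows "lattice_polytope ((+) t ` P)"
  using assms unfolding lattice_polytope_def
  by (auto simp: polytope_translation_eq extreme_points_of_translation aff_dim_translation_eq
      intro!: int_lattice_add)

text \<open>
  The interior lattice point becomes the origin. For the translate \<open>Q\<close>, the lattice points of \<open>k Q\<close> are among
  the interior lattice points of \<open>(k + 1) Q\<close>, and there are equally many of both, so the two sets are equal.
\<close>

theorem proposition1p8:
  fixes P :: "(real ^ 'n) set"
  assumes "lattice_polytope P"
    and "\<And>s :: complex. poly (ehrhart_poly P) s = 0 \<Longrightarrow> Re s = - 1 / 2"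
  shows "\<exists>t\<in>int_lattice. reflexive_polytope ((+) t ` P) \<and>
           measure lebesgue P \<le> 2 ^ CARD('n)"
proof -
  have "card (interior P \<inter> int_lattice) = 1"
    using lattice_count_interior[OF assms] by (simp add: lattice_count_def)
  then obtain a where a: "interior P \<inter> int_lattice = {a}"
    by (auto simp: card_1_singleton_iff)
  define t where "t = - a"
  define Q where "Q = (+) t ` P"
  have t: "t \<in> int_lattice"
    using a by (auto simp: t_def intro: int_lattice_minus)
  have Q: "lattice_polytope Q"
    unfolding Q_def by (rule lattice_polytope_translation[OF assms(1) t])
  have "ehrhart_poly Q = ehrhart_poly P"
    unfolding Q_def by (rule ehrhart_poly_translation[OF t])
  then have roots: "\<And>s. poly (ehrhart_poly Q) s = 0 \<Longrightarrow> Re s = - 1 / 2"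
    using assms(2) by simp
  have Q': "compact Q" "convex Q"
    using Q by (simp_all add: lattice_polytope_def polytope_imp_compact polytope_imp_convex)
  have zero: "0 \<in> interior Q"
    unfolding Q_def interior_translation using a by (auto simp: t_def image_iff)
  have finite_shell: "finite ((*\<^sub>R) r ` R \<inter> int_lattice)" if "R \<subseteq> Q" for r and R :: "(real ^ 'n) set"
    by (intro finite_int_lattice_bounded bounded_scaling)
       (rule bounded_subset[OF compact_imp_bounded[OF Q'(1)] that])
  have "(*\<^sub>R) (real (Suc k)) ` interior Q \<inter> int_lattice \<subseteq> (*\<^sub>R) (real k) ` Q" for k
  proof (cases "k = 0")
    case True
    have "card (interior Q \<inter> int_lattice) = 1"
      using lattice_count_interior[OF Q roots] by (simp add: lattice_count_def)
    then obtain b where b: "interior Q \<inter> int_lattice = {b}"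
      by (auto simp: card_1_singleton_iff)
    moreover have "0 \<in> interior Q \<inter> int_lattice"
      using zero by simp
    ultimately have "interior Q \<inter> int_lattice = {0}"
      by (metis singletonD)
    moreover have "0 \<in> Q"
      using zero interior_subset by blast
    ultimately show ?thesis
      using True by (auto simp: image_iff)
  next
    case False
    have "(*\<^sub>R) (real k) ` Q \<subseteq> (*\<^sub>R) (real (Suc k)) ` interior Q"
    proof
      fix x assume "x \<in> (*\<^sub>R) (real k) ` Q"
      then obtain p where p: "p \<in> Q" "x = real k *\<^sub>R p"
        by blast
      have "p - (1 / real (Suc k)) *\<^sub>R (p - 0) \<in> interior Q"
        using p by (intro mem_interior_convex_shrink[OF Q'(2) zero]) auto
      moreover have "x = real (Suc k) *\<^sub>R (p - (1 / real (Suc k)) *\<^sub>R (p - 0))"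
        by (simp add: p scaleR_right_diff_distrib scaleR_left_distrib del: of_nat_Suc) (simp add: scaleR_left_distrib)
      ultimately show "x \<in> (*\<^sub>R) (real (Suc k)) ` interior Q"
        by blast
    qed
    then have "(*\<^sub>R) (real k) ` Q \<inter> int_lattice \<subseteq> (*\<^sub>R) (real (Suc k)) ` interior Q \<inter> int_lattice"
      by blast
    moreover have "card ((*\<^sub>R) (real (Suc k)) ` interior Q \<inter> int_lattice) = card ((*\<^sub>R) (real k) ` Q \<inter> int_lattice)"
      using lattice_count_interior_Suc[OF Q roots, of k] False by (simp add: lattice_count_def)
    ultimately have "(*\<^sub>R) (real k) ` Q \<inter> int_lattice = (*\<^sub>R) (real (Suc k)) ` interior Q \<inter> int_lattice"
      using finite_shell[OF interior_subset] by (intro card_subset_eq) auto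
    then show ?thesis
      by blast
  qed
  then have "lattice_polytope (polar Q)"
    by (rule lattice_polytope_polar[OF Q zero])
  then have "reflexive_polytope Q"
    using Q zero by (simp add: reflexive_polytope_def)
  moreover have "measure lebesgue Q \<le> 2 ^ CARD('n)"
    by (rule volume_le_two_power[OF Q' zero lattice_count_growth[OF Q roots]])
  then have "measure lebesgue P \<le> 2 ^ CARD('n)"
    unfolding Q_def by (simp only: measure_translation)
  ultimately show ?thesis
    using t unfolding Q_def by blast
qed

end
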